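(* Let $b,\sigma:[0,\infty)\times\mathbb{R}\to\mathbb{R}$, $Z:\Omega\to\mathbb{R}$, $0<\alpha<1$ and $\frac{1-\alpha}{2}<\beta<\frac{1+\alpha}{2}$. Let $\xi_\alpha$ be fractional Brownian motion with exponent $\alpha$ on the probability space $(\Omega,\mathcal{F},P)$. Suppose $b$ is globally Lipschitz in $t$ and $x$, and $\sigma\in C^1([0,\infty)\times\mathbb{R})$ with $\sigma$, $\sigma'_t$, $\sigma'_x$ globally Lipschitz in $t$ and $x$. Then for every $T>0$ the stochastic differential equation $$dX(t,\omega)=b(t,X(t,\omega))\,dt+\sigma(t,X(t,\omega))\,d\xi_\alpha(t,\omega),\qquad X(0,\omega)=Z(\omega),$$ has, with probability $1$, a unique solution in $\mathcal{C}^{\beta}([0,T])$.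
   Context: $\mathcal{C}^{\beta}(I)$ denotes the space of real-valued H\"older-continuous functions on the interval $I$ with exponent $\beta$. Fractional Brownian motion $\xi_\alpha(t,\omega)$, $t\ge 0$, with exponent $\alpha$ is the centered Gaussian process with stationary increments and covariance $E(\xi_\alpha(s)\xi_\alpha(t))=C(s^{1+\alpha}+t^{1+\alpha}-|s-t|^{1+\alpha})$, where $C=-\frac{\Gamma(1-\alpha)}{\alpha}\,\frac{\cos(\frac{1+\alpha}{2}\pi)}{\frac{1+\alpha}{2}\pi}>0$; its trajectories (in a continuous version) are almost surely H\"older continuous on compact intervals with every exponent less than $\frac{1+\alpha}{2}$. The equation is understood pathwise: for a.e. $\omega$, a solution in $\mathcal{C}^\beta([0,T])$ is a function $X(\cdot,\omega)\in\mathcal{C}^\beta([0,T])$ with $X(t,\omega)=Z(\omega)+\int_0^t b(\tau,X(\tau,\omega))\,d\tau+\int_0^t\sigma(\tau,X(\tau,\omega))\,d\xi_\alpha(\tau,\omega)$ for all $t\in[0,T]$, the last integral being a Stieltjes integral (limit of Riemann sums) for the fixed path $\xi_\alpha(\cdot,\omega)$. *)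

theory Defs
  imports "HOL-Probability.Probability"
begin

text \<open>
  Elements of the space are functions on \<open>I\<close>, i.e. extensional outside \<open>I\<close>, so that equality
  in the space is equality on \<open>I\<close>.
\<close>

definition holder_space :: "real \<Rightarrow> real set \<Rightarrow> (real \<Rightarrow> real) set" where
  "holder_space \<beta> I =
    {f \<in> extensional I. \<exists>C. \<forall>x\<in>I. \<forall>y\<in>I. \<bar>f x - f y\<bar> \<le> C * \<bar>x - y\<bar> powr \<beta>}"

text \<open>Point masses count as (degenerate) normal laws.\<close>

definition normal_rv :: "'a measure \<Rightarrow> ('a \<Rightarrow> real) \<Rightarrow> bool" where
  "normal_rv M Y \<longleftrightarrow>
    (\<exists>\<mu> s. s > 0 \<and> distributed M lborel Y (normal_density \<mu> s)) \<or>
    (Y \<in> borel_measurable M \<and> (\<exists>\<mu>. AE \<omega> in M. Y \<omega> = \<mu>))"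

definition gaussian_process :: "'a measure \<Rightarrow> real set \<Rightarrow> (real \<Rightarrow> 'a \<Rightarrow> real) \<Rightarrow> bool" where
  "gaussian_process M I \<xi> \<longleftrightarrow>
    (\<forall>t\<in>I. \<xi> t \<in> borel_measurable M) \<and>
    (\<forall>J c. finite J \<and> J \<subseteq> I \<longrightarrow> normal_rv M (\<lambda>\<omega>. \<Sum>t\<in>J. c t * \<xi> t \<omega>))"

definition stationary_increments :: "'a measure \<Rightarrow> (real \<Rightarrow> 'a \<Rightarrow> real) \<Rightarrow> bool" where
  "stationary_increments M \<xi> \<longleftrightarrow>
    (\<forall>h\<ge>0. \<forall>J. finite J \<and> J \<subseteq> {0..} \<longrightarrow>
      distr M (Pi\<^sub>M J (\<lambda>_. borel)) (\<lambda>\<omega>. \<lambda>t\<in>J. \<xi> (h + t) \<omega> - \<xi> h \<omega>) =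
      distr M (Pi\<^sub>M J (\<lambda>_. borel)) (\<lambda>\<omega>. \<lambda>t\<in>J. \<xi> t \<omega> - \<xi> 0 \<omega>))"

definition fbm_const :: "real \<Rightarrow> real" where
  "fbm_const \<alpha> =
    - (Gamma (1 - \<alpha>) / \<alpha>) * (cos ((1 + \<alpha>) / 2 * pi) / ((1 + \<alpha>) / 2 * pi))"

text \<open>
  The exponent \<open>\<alpha>\<close> corresponds to the Hurst index \<open>(1 + \<alpha>) / 2\<close>.
  The last conjunct selects a continuous version of the process; Hoelder continuity of the
  paths is not part of the definition. Only times \<open>t \<ge> 0\<close> are constrained.
\<close>

definition fractional_brownian_motion ::
    "'a measure \<Rightarrow> real \<Rightarrow> (real \<Rightarrow> 'a \<Rightarrow> real) \<Rightarrow> bool" where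
  "fractional_brownian_motion M \<alpha> \<xi> \<longleftrightarrow>
    gaussian_process M {0..} \<xi> \<and>
    stationary_increments M \<xi> \<and>
    (\<forall>t\<ge>0. (LINT \<omega>|M. \<xi> t \<omega>) = 0) \<and>
    (\<forall>s\<ge>0. \<forall>t\<ge>0. (LINT \<omega>|M. \<xi> s \<omega> * \<xi> t \<omega>) =
      fbm_const \<alpha> * (s powr (1 + \<alpha>) + t powr (1 + \<alpha>) - \<bar>s - t\<bar> powr (1 + \<alpha>))) \<and>
    (AE \<omega> in M. continuous_on {0..} (\<lambda>t. \<xi> t \<omega>))"

text \<open>
  \<open>f\<close> is continuously differentiable on \<open>[0,\<infinity>) \<times> \<real>\<close> with partial derivatives \<open>ft\<close>, \<open>fx\<close>;
  at \<open>t = 0\<close> the time derivative is one-sided.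
\<close>

definition C1_with_partials ::
    "(real \<Rightarrow> real \<Rightarrow> real) \<Rightarrow> (real \<Rightarrow> real \<Rightarrow> real) \<Rightarrow> (real \<Rightarrow> real \<Rightarrow> real) \<Rightarrow> bool" where
  "C1_with_partials f ft fx \<longleftrightarrow>
    (\<forall>t\<ge>0. \<forall>x. ((\<lambda>s. f s x) has_real_derivative ft t x) (at t within {0..})) \<and>
    (\<forall>t\<ge>0. \<forall>x. ((\<lambda>y. f t y) has_real_derivative fx t x) (at x)) \<and>
    continuous_on ({0..} \<times> UNIV) (\<lambda>(t, x). ft t x) \<and>
    continuous_on ({0..} \<times> UNIV) (\<lambda>(t, x). fx t x)"

definition globally_lipschitz :: "(real \<Rightarrow> real \<Rightarrow> real) \<Rightarrow> bool" where
  "globally_lipschitz f \<longleftrightarrow> (\<exists>L. L-lipschitz_on ({0..} \<times> UNIV) (\<lambda>(t, x). f t x))"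

text \<open>
  Riemann--Stieltjes integral of \<open>f\<close> with respect to \<open>g\<close> over \<open>[a,b]\<close>: partition points
  \<open>p 0 \<le> \<dots> \<le> p n\<close>, arbitrary tags \<open>u i\<close>, limit as the mesh tends to zero.
\<close>

definition has_stieltjes_integral ::
    "(real \<Rightarrow> real) \<Rightarrow> (real \<Rightarrow> real) \<Rightarrow> real \<Rightarrow> real \<Rightarrow> real \<Rightarrow> bool" where
  "has_stieltjes_integral f g a b y \<longleftrightarrow>
    (\<forall>\<epsilon>>0. \<exists>\<delta>>0. \<forall>(n::nat) p u.
      p 0 = a \<and> p n = b \<and>
      (\<forall>i<n. p i \<le> p (Suc i) \<and> p (Suc i) - p i < \<delta> \<and> u i \<in> {p i..p (Suc i)}) \<longrightarrow>
      \<bar>(\<Sum>i<n. f (u i) * (g (p (Suc i)) - g (p i))) - y\<bar> < \<epsilon>)"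

text \<open>Solution on \<open>[0,T]\<close>, in integral form, with initial value \<open>z\<close> and driving path \<open>g\<close>.\<close>

definition is_solution ::
    "(real \<Rightarrow> real \<Rightarrow> real) \<Rightarrow> (real \<Rightarrow> real \<Rightarrow> real) \<Rightarrow> real \<Rightarrow> (real \<Rightarrow> real) \<Rightarrow> real \<Rightarrow>
      (real \<Rightarrow> real) \<Rightarrow> bool" where
  "is_solution b \<sigma> z g T X \<longleftrightarrow>
    (\<forall>t\<in>{0..T}. \<exists>I J.
      ((\<lambda>\<tau>. b \<tau> (X \<tau>)) has_integral I) {0..t} \<and>
      has_stieltjes_integral (\<lambda>\<tau>. \<sigma> \<tau> (X \<tau>)) g 0 t J \<and>
      X t = z + I + J)"

end

theory Submission imports Defs
begin

text \<open>
  The randomness enters only through the regularity of the driving path. An increment of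
  fractional Brownian motion is a centred Gaussian variable with variance a multiple of
  \<open>\<bar>t - s\<bar>\<^bsup>1+\<alpha>\<^esup>\<close>, so its \<open>2k\<close>-th moment is a multiple of \<open>\<bar>t - s\<bar>\<^bsup>k(1+\<alpha>)\<^esup>\<close>, and the Kolmogorov
  criterion gives, almost surely, \<open>\<gamma>\<close>-Hoelder paths on \<open>[0,T]\<close> for each \<open>\<gamma> < (1+\<alpha>)/2\<close>
  (\<open>fbm_holder_paths\<close>). Since \<open>(1-\<alpha>)/2 < \<beta> < (1+\<alpha>)/2\<close>, the exponent can be chosen such that
  \<open>\<beta> < \<gamma> < 1\<close> and \<open>\<beta> + \<gamma> > 1\<close>. From then on the path is fixed and the argument is deterministic
  (\<open>unique_solution_of_holder_driver\<close>).

  Because \<open>\<beta> + \<gamma> > 1\<close>, the Riemann sums of a \<open>\<beta>\<close>-Hoelder integrand against a \<open>\<gamma>\<close>-Hoelder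
  integrator converge, and the integral over \<open>[s,t]\<close> differs from its one-point approximation
  \<open>f(s) (g(t) - g(s))\<close> by \<open>O((t-s)\<^bsup>\<beta>+\<gamma>\<^esup>)\<close> (Young; here \<open>young_integral\<close>, deduced from the sewing
  lemma \<open>sewing\<close>). Hence the right-hand side of the equation maps \<open>\<beta>\<close>-Hoelder paths to paths
  whose increments are \<open>O((t-s)\<^bsup>\<gamma>\<^esup>)\<close>, and on an interval of length \<open>h\<close> the surplus exponent
  turns into a small factor \<open>h\<^bsup>\<gamma>-\<beta>\<^esup>\<close>. The same exponent \<open>\<beta>\<close> therefore serves for existence and for
  uniqueness, even when \<open>\<beta> \<le> 1/2\<close>.

  The contraction constant is not uniform: the difference of \<open>\<sigma>(t, X(t))\<close> and \<open>\<sigma>(t, Y(t))\<close> has a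
  Hoelder constant that involves the Hoelder constants of \<open>X\<close> and \<open>Y\<close> themselves
  (\<open>solution_map_contraction\<close>). The growth estimate \<open>solution_map_growth\<close>, by contrast, is
  affine with constants independent of the solution, so it yields an a priori bound on all
  solutions (\<open>a_priori_bound\<close>). With this bound a single step length works on the whole of
  \<open>[0,T]\<close>: uniqueness follows step by step, and a solution is extended from \<open>[0,a]\<close> to
  \<open>[0,a+h]\<close> by Picard iteration (\<open>extend_fixed_point\<close>).
\<close>

section \<open>Hoelder bounds\<close>

definition holder_bound :: "real \<Rightarrow> real \<Rightarrow> real set \<Rightarrow> (real \<Rightarrow> real) \<Rightarrow> bool" where
  "holder_bound \<beta> K S f \<longleftrightarrow> (\<forall>x\<in>S. \<forall>y\<in>S. \<bar>f x - f y\<bar> \<le> K * \<bar>x - y\<bar> powr \<beta>)"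

lemma holder_boundD:
  "holder_bound \<beta> K S f \<Longrightarrow> x \<in> S \<Longrightarrow> y \<in> S \<Longrightarrow> \<bar>f x - f y\<bar> \<le> K * \<bar>x - y\<bar> powr \<beta>"
  by (simp add: holder_bound_def)

lemma holder_bound_subset:
  "holder_bound \<beta> K S f \<Longrightarrow> S' \<subseteq> S \<Longrightarrow> holder_bound \<beta> K S' f"
  unfolding holder_bound_def by blast

lemma holder_bound_mono:
  assumes "holder_bound \<beta> K S f" "K \<le> K'"
  shows "holder_bound \<beta> K' S f"
  using assms unfolding holder_bound_def
  by (meson mult_right_mono order_trans powr_ge_zero)

lemma holder_bound_cong:
  "(\<And>x. x \<in> S \<Longrightarrow> f x = f' x) \<Longrightarrow> holder_bound \<beta> K S f \<longleftrightarrow> holder_bound \<beta> K S f'"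
  unfolding holder_bound_def by auto

lemma holder_boundI_ordered:
  assumes "\<And>s t. s \<in> S \<Longrightarrow> t \<in> S \<Longrightarrow> s < t \<Longrightarrow> \<bar>f t - f s\<bar> \<le> K * (t - s) powr \<beta>"
  shows "holder_bound \<beta> K S f"
  unfolding holder_bound_def
proof (intro ballI)
  fix x y assume "x \<in> S" "y \<in> S"
  then show "\<bar>f x - f y\<bar> \<le> K * \<bar>x - y\<bar> powr \<beta>"
    using assms[of x y] assms[of y x]
    by (cases x y rule: linorder_cases) (auto simp: abs_minus_commute)
qed

lemma holder_bound_diff:
  assumes "holder_bound \<beta> K S f" "holder_bound \<beta> K' S f'"
  shows "holder_bound \<beta> (K + K') S (\<lambda>x. f x - f' x)"
  unfolding holder_bound_def
proof (intro ballI)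
  fix x y assume xy: "x \<in> S" "y \<in> S"
  have "\<bar>(f x - f' x) - (f y - f' y)\<bar> \<le> \<bar>f x - f y\<bar> + \<bar>f' x - f' y\<bar>" by linarith
  also have "\<dots> \<le> K * \<bar>x - y\<bar> powr \<beta> + K' * \<bar>x - y\<bar> powr \<beta>"
    using holder_boundD[OF assms(1) xy] holder_boundD[OF assms(2) xy] by linarith
  finally show "\<bar>(f x - f' x) - (f y - f' y)\<bar> \<le> (K + K') * \<bar>x - y\<bar> powr \<beta>"
    by (simp add: algebra_simps)
qed

lemma holder_bound_nonneg:
  assumes "holder_bound \<beta> K S f"
  obtains K' where "K' \<ge> 0" "holder_bound \<beta> K' S f"
proof
  show "holder_bound \<beta> \<bar>K\<bar> S f" using assms by (rule holder_bound_mono) simp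
qed simp

lemma holder_bound_continuous_on:
  assumes "holder_bound \<beta> K S f" "\<beta> > 0"
  shows "continuous_on S f"
  unfolding continuous_on_def
proof
  fix x assume x: "x \<in> S"
  have "((\<lambda>y. K * \<bar>y - x\<bar> powr \<beta>) \<longlongrightarrow> K * \<bar>x - x\<bar> powr \<beta>) (at x within S)"
    using \<open>\<beta> > 0\<close> by (intro tendsto_intros) auto
  then have lim: "((\<lambda>y. K * \<bar>y - x\<bar> powr \<beta>) \<longlongrightarrow> 0) (at x within S)" by simp
  have "\<forall>\<^sub>F y in at x within S. norm (f y - f x) \<le> K * \<bar>y - x\<bar> powr \<beta>"
    using holder_boundD[OF assms(1) _ x]
    by (auto simp: eventually_at_topological)
  then have "((\<lambda>y. f y - f x) \<longlongrightarrow> 0) (at x within S)"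
    by (rule Lim_null_comparison) (rule lim)
  then show "(f \<longlongrightarrow> f x) (at x within S)" by (simp add: LIM_zero_iff)
qed

lemma holder_bound_append:
  assumes 1: "holder_bound \<beta> K {a..m} f" and 2: "holder_bound \<beta> K' {m..c} f"
    and "K \<ge> 0" "K' \<ge> 0" "\<beta> > 0"
  shows "holder_bound \<beta> (K + K') {a..c} f"
proof (rule holder_boundI_ordered)
  fix s t assume st: "s \<in> {a..c}" "t \<in> {a..c}" "s < t"
  have *: "\<bar>f v - f u\<bar> \<le> L * (t - s) powr \<beta>"
    if "holder_bound \<beta> L I f" "u \<in> I" "v \<in> I" "s \<le> u" "u \<le> v" "v \<le> t" "L \<ge> 0" for u v L I
  proof -
    have "\<bar>f v - f u\<bar> \<le> L * \<bar>v - u\<bar> powr \<beta>" using that by (intro holder_boundD) auto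
    also have "\<dots> \<le> L * (t - s) powr \<beta>"
      using that \<open>\<beta> > 0\<close> by (intro mult_left_mono powr_mono2) auto
    finally show ?thesis .
  qed
  have n: "0 \<le> K * (t - s) powr \<beta>" "0 \<le> K' * (t - s) powr \<beta>" using assms by auto
  consider "t \<le> m" | "m \<le> s" | "s < m" "m < t" by linarith
  then show "\<bar>f t - f s\<bar> \<le> (K + K') * (t - s) powr \<beta>"
  proof cases
    case 1 then show ?thesis using *[OF assms(1), of s t] st n \<open>K \<ge> 0\<close> unfolding distrib_right by fastforce
  next
    case 2 then show ?thesis using *[OF assms(2), of s t] st n \<open>K' \<ge> 0\<close> unfolding distrib_right by fastforce
  next
    case 3 then show ?thesis
      using *[OF assms(1), of s m] *[OF assms(2), of m t] st n assms by (auto simp: algebra_simps)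
  qed
qed

text \<open>
  All fixed-point estimates have the form: a Hoelder constant \<open>K\<close> may be replaced by the average
  of \<open>K\<close> and \<open>m\<close>. Iterating drives the constant to \<open>m\<close>. With \<open>m = 0\<close> this is the uniqueness part
  of the contraction principle; with \<open>m > 0\<close> it gives an a priori bound.
\<close>

lemma holder_bound_halving:
  assumes "holder_bound \<beta> K S f" "K \<ge> 0" "m \<ge> 0"
    and step: "\<And>K. K \<ge> 0 \<Longrightarrow> holder_bound \<beta> K S f \<Longrightarrow> holder_bound \<beta> ((m + K) / 2) S f"
  shows "holder_bound \<beta> m S f"
proof -
  define k where "k n = m + (K - m) * (1/2) ^ n" for n :: nat
  have k: "holder_bound \<beta> (k n) S f \<and> k n \<ge> 0" for n
  proof (induction n)
    case 0 then show ?case using assms by (simp add: k_def)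
  next
    case (Suc n)
    have "k (Suc n) = (m + k n) / 2" by (simp add: k_def field_simps)
    then show ?case using Suc step[of "k n"] \<open>m \<ge> 0\<close> by (simp only:) simp
  qed
  have "k \<longlonglongrightarrow> m + (K - m) * 0"
    unfolding k_def by (intro tendsto_intros LIMSEQ_power_zero) simp
  then have lim: "k \<longlonglongrightarrow> m" by simp
  show ?thesis unfolding holder_bound_def
  proof (intro ballI)
    fix x y assume xy: "x \<in> S" "y \<in> S"
    have "(\<lambda>n. k n * \<bar>x - y\<bar> powr \<beta>) \<longlonglongrightarrow> m * \<bar>x - y\<bar> powr \<beta>"
      by (intro tendsto_intros lim)
    then show "\<bar>f x - f y\<bar> \<le> m * \<bar>x - y\<bar> powr \<beta>"
      by (rule LIMSEQ_le_const) (use k holder_boundD xy in blast)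
  qed
qed

text \<open>
  The common limit argument behind dyadic refinement, dyadic chaining and Picard iteration.
\<close>

lemma geometric_increments_limit:
  fixes a :: "nat \<Rightarrow> real"
  assumes step: "\<And>n. \<bar>a (Suc n) - a n\<bar> \<le> B * r ^ n" and r: "0 \<le> r" "r < 1"
  obtains l where "a \<longlonglongrightarrow> l" "\<And>n. \<bar>l - a n\<bar> \<le> B * r ^ n / (1 - r)"
proof -
  have sB: "summable (\<lambda>n. B * r ^ n)" using r by (intro summable_mult summable_geometric) auto
  have s: "summable (\<lambda>n. a (Suc n) - a n)"
    by (rule summable_comparison_test'[OF sB, of 0]) (use step in auto)
  define l where "l = a 0 + (\<Sum>n. a (Suc n) - a n)"
  have "(\<lambda>n. a 0 + (\<Sum>i<n. a (Suc i) - a i)) \<longlonglongrightarrow> l"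
    unfolding l_def by (intro tendsto_intros summable_LIMSEQ s)
  then have lim: "a \<longlonglongrightarrow> l" by (simp add: sum_lessThan_telescope)
  have "\<bar>l - a n\<bar> \<le> B * r ^ n / (1 - r)" for n
  proof -
    have part: "\<bar>a (n + m) - a n\<bar> \<le> B * r ^ n * (\<Sum>i<m. r ^ i)" for m
    proof (induction m)
      case (Suc m)
      have "\<bar>a (n + Suc m) - a n\<bar> \<le> \<bar>a (Suc (n + m)) - a (n + m)\<bar> + \<bar>a (n + m) - a n\<bar>"
        by simp
      also have "\<dots> \<le> B * r ^ (n + m) + B * r ^ n * (\<Sum>i<m. r ^ i)"
        using step[of "n + m"] Suc by linarith
      finally show ?case by (simp add: algebra_simps power_add)
    qed simp
    have "(\<lambda>m. \<bar>a (n + m) - a n\<bar>) \<longlonglongrightarrow> \<bar>l - a n\<bar>"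
      using LIMSEQ_ignore_initial_segment[OF lim, of n]
      by (intro tendsto_intros) (simp add: add.commute)
    moreover have "(\<lambda>m. B * r ^ n * (\<Sum>i<m. r ^ i)) \<longlonglongrightarrow> B * r ^ n * (\<Sum>i. r ^ i)"
      using r by (intro tendsto_intros summable_LIMSEQ summable_geometric) auto
    ultimately have "\<bar>l - a n\<bar> \<le> B * r ^ n * (\<Sum>i. r ^ i)"
      by (rule LIMSEQ_le) (use part in auto)
    then show ?thesis using r by (simp add: suminf_geometric)
  qed
  with lim show ?thesis by (rule that)
qed


section \<open>Dyadic grids and the sewing lemma\<close>

text \<open>
  The index of the cell of the grid \<open>a + h \<nat>\<close> that contains \<open>t\<close>; cells are closed on the left.
\<close>

definition grid_index :: "real \<Rightarrow> real \<Rightarrow> real \<Rightarrow> nat" where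
  "grid_index a h t = nat \<lfloor>(t - a) / h\<rfloor>"

lemma grid_index_bounds:
  assumes "h > 0" "a \<le> t"
  shows "a + real (grid_index a h t) * h \<le> t" "t < a + (real (grid_index a h t) + 1) * h"
proof -
  have "0 \<le> \<lfloor>(t - a) / h\<rfloor>" using assms by simp
  then have eq: "real (grid_index a h t) = of_int \<lfloor>(t - a) / h\<rfloor>"
    unfolding grid_index_def by simp
  have "real (grid_index a h t) \<le> (t - a) / h" "(t - a) / h < real (grid_index a h t) + 1"
    unfolding eq by linarith+
  then show "a + real (grid_index a h t) * h \<le> t" "t < a + (real (grid_index a h t) + 1) * h"
    using \<open>h > 0\<close> by (simp_all add: pos_le_divide_eq pos_divide_less_eq)
qed

lemma grid_index_unique:
  assumes "h > 0" "a + real c * h \<le> t" "t < a + (real c + 1) * h"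
  shows "grid_index a h t = c"
proof -
  have "\<lfloor>(t - a) / h\<rfloor> = int c"
    using assms by (intro floor_unique) (auto simp: field_simps)
  then show ?thesis by (simp add: grid_index_def)
qed

lemma grid_index_start: "h > 0 \<Longrightarrow> grid_index a h a = 0"
  by (rule grid_index_unique) auto

lemma grid_index_mono:
  assumes "h > 0" "s \<le> t" shows "grid_index a h s \<le> grid_index a h t"
  unfolding grid_index_def using assms
  by (intro nat_mono floor_mono divide_right_mono) auto

lemma grid_index_diff:
  assumes "h > 0" "a \<le> s" "s \<le> t"
  shows "real (grid_index a h t) - real (grid_index a h s) < (t - s) / h + 1"
proof -
  have "(real (grid_index a h t) - real (grid_index a h s) - 1) * h < t - s"
    using grid_index_bounds(1)[of h a t] grid_index_bounds(2)[of h a s] assms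
    by (simp add: algebra_simps)
  then show ?thesis using assms(1) by (simp add: field_simps)
qed

lemma grid_index_adjacent:
  assumes "h > 0" "a \<le> s" "s \<le> t" "t - s \<le> h"
  shows "grid_index a h t = grid_index a h s \<or> grid_index a h t = Suc (grid_index a h s)"
proof -
  have "(t - s) / h \<le> 1" using assms by simp
  then have "real (grid_index a h t) - real (grid_index a h s) < 2"
    using grid_index_diff[OF assms(1-3)] by linarith
  then show ?thesis using grid_index_mono[OF assms(1,3), of a] by linarith
qed

lemma grid_index_halve:
  assumes "h > 0" "a \<le> t"
  shows "grid_index a (h/2) t = 2 * grid_index a h t \<and> t < a + (real (grid_index a h t) + 1/2) * h
       \<or> grid_index a (h/2) t = Suc (2 * grid_index a h t) \<and> a + (real (grid_index a h t) + 1/2) * h \<le> t"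
proof (cases "t < a + (real (grid_index a h t) + 1/2) * h")
  case True
  have "grid_index a (h/2) t = 2 * grid_index a h t"
    using grid_index_bounds[OF assms] True assms
    by (intro grid_index_unique) (auto simp: algebra_simps)
  with True show ?thesis by simp
next
  case False
  have "grid_index a (h/2) t = Suc (2 * grid_index a h t)"
    using grid_index_bounds[OF assms] False assms
    by (intro grid_index_unique) (auto simp: algebra_simps)
  with False show ?thesis by simp
qed

text \<open>
  The level at which a distance is compared with the dyadic grid: there two points at distance
  \<open>d\<close> lie in the same or in adjacent cells, while the cell length is still at most \<open>2 d\<close>.
\<close>

lemma dyadic_scale:
  fixes d l :: real
  assumes "0 < d" "d \<le> l"
  obtains N where "l / 2 ^ Suc N < d" "d \<le> l / 2 ^ N"
proof -
  have "(\<lambda>n. l * (1/2)^n) \<longlonglongrightarrow> l * 0" by (intro tendsto_intros LIMSEQ_power_zero) simp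
  then have "\<forall>\<^sub>F n in sequentially. l * (1/2)^n < d"
    using order_tendstoD(2)[of "\<lambda>n. l * (1/2)^n" 0 _ d] assms by simp
  then obtain n where "l * (1/2)^n < d" by (auto simp: eventually_sequentially)
  then have ex: "\<exists>n. l / 2 ^ n < d" by (auto simp: power_one_over)
  define M where "M = (LEAST n. l / 2 ^ n < d)"
  have M: "l / 2 ^ M < d" unfolding M_def by (rule LeastI_ex[OF ex])
  then obtain N where N: "M = Suc N" using assms by (cases M) auto
  have "\<not> l / 2 ^ N < d" using not_less_Least[of N "\<lambda>n. l / 2 ^ n < d"] N M_def by simp
  with M N that show ?thesis by auto
qed

definition sewing_const :: "real \<Rightarrow> real" where
  "sewing_const \<theta> = (2 + 4 / (1 - 2 powr (1 - \<theta>))) * 2 powr \<theta>"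

lemma sewing_const_nonneg: "\<theta> > 1 \<Longrightarrow> sewing_const \<theta> \<ge> 0"
  using powr_le_cancel_iff[of 2 "1 - \<theta>" 0] by (simp add: sewing_const_def)

lemma sum_pairs: "(\<Sum>i<2 * m. f i) = (\<Sum>i<m. f (2 * i) + f (Suc (2 * i)))"
  for f :: "nat \<Rightarrow> 'b::comm_monoid_add"
  by (induction m) (simp_all add: add.assoc)

text \<open>
  The sewing lemma. Along the dyadic partition of level \<open>n\<close>, cut off at \<open>t\<close>, let \<open>A n t\<close> be the
  sum of \<open>\<mu>\<close> over the cells. Halving every cell changes \<open>A n t - A n s\<close> by one defect of \<open>\<mu>\<close> per
  cell that meets \<open>[s,t]\<close>. There are about \<open>(t-s)/h\<close> such cells and each defect is \<open>O(h\<^bsup>\<theta>\<^esup>)\<close>; as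
  \<open>\<theta> > 1\<close>, the changes decay geometrically once \<open>h\<close> is below \<open>t - s\<close>. Starting at the level where
  \<open>h\<close> is comparable with \<open>t - s\<close> makes the total error \<open>O((t-s)\<^bsup>\<theta>\<^esup>)\<close>. All the \<open>A n\<close> come from
  one grid, so that the increments of the limit are additive for arbitrary \<open>s\<close>, \<open>t\<close>, not only for
  dyadic ones.
\<close>

lemma sewing:
  fixes \<mu> :: "real \<Rightarrow> real \<Rightarrow> real"
  assumes ab: "a \<le> b" and \<theta>: "\<theta> > 1" and K: "K \<ge> 0"
    and defect: "\<And>s u t. a \<le> s \<Longrightarrow> s \<le> u \<Longrightarrow> u \<le> t \<Longrightarrow> t \<le> b \<Longrightarrow>
      \<bar>\<mu> s u + \<mu> u t - \<mu> s t\<bar> \<le> K * (t - s) powr \<theta>"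
  obtains J where "J a = 0"
    "\<And>s t. a \<le> s \<Longrightarrow> s \<le> t \<Longrightarrow> t \<le> b \<Longrightarrow>
      \<bar>J t - J s - \<mu> s t\<bar> \<le> sewing_const \<theta> * K * (t - s) powr \<theta>"
proof (cases "a = b")
  case True
  have "\<mu> a a = 0" using defect[of a a a] True by simp
  then have "\<mu> s t = 0" if "a \<le> s" "s \<le> t" "t \<le> b" for s t
    using that True by (metis order.antisym order_trans)
  with True K show ?thesis
    by (intro that[of "\<lambda>_. 0"]) (simp_all add: sewing_const_nonneg \<theta>)
next
  case False
  with ab have ab: "a < b" by simp
  define h where "h n = (b - a) / 2 ^ n" for n :: nat
  define P where "P n i = a + real i * h n" for n i :: nat
  define c where "c n t = grid_index a (h n) t" for n t
  define A where "A n t = (\<Sum>i<c n t. \<mu> (P n i) (P n (Suc i))) + \<mu> (P n (c n t)) t" for n t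
  have h: "h n > 0" for n using ab by (simp add: h_def)
  have h_Suc: "h (Suc n) = h n / 2" for n by (simp add: h_def)
  have P_double: "P (Suc n) (2 * i) = P n i" for n i by (simp add: P_def h_Suc)
  have P_mono: "P n i \<le> P n j" if "i \<le> j" for n i j
    using that h[of n] by (simp add: P_def mult_right_mono)
  have P_Suc: "P n (Suc i) - P n i = h n" for n i by (simp add: P_def algebra_simps)
  have P_ge: "a \<le> P n i" for n i using h[of n] by (simp add: P_def)
  have c: "P n (c n t) \<le> t" "t < P n (Suc (c n t))" if "a \<le> t" for n t
    using grid_index_bounds[OF h that, of n] by (auto simp: P_def c_def add.commute)
  have c_a: "c n a = 0" for n by (simp add: c_def grid_index_start h)
  have \<mu>0: "\<mu> t t = 0" if "a \<le> t" "t \<le> b" for t using defect[of t t t] that by simp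
  have A_a: "A n a = 0" for n using \<mu>0[of a] ab by (simp add: A_def c_a P_def)

  \<comment> \<open>\<open>D n i\<close> is the defect from halving the full cell \<open>i\<close>; \<open>e n t\<close> is the one from the cell cut
    off at \<open>t\<close>, which vanishes if \<open>t\<close> lies in the left half.\<close>
  define D where "D n i = \<mu> (P n i) (P (Suc n) (Suc (2 * i))) +
      \<mu> (P (Suc n) (Suc (2 * i))) (P n (Suc i)) - \<mu> (P n i) (P n (Suc i))" for n i
  define e where "e n t = (if c (Suc n) t = 2 * c n t then 0 else
      \<mu> (P n (c n t)) (P (Suc n) (Suc (2 * c n t))) +
      \<mu> (P (Suc n) (Suc (2 * c n t))) t - \<mu> (P n (c n t)) t)" for n t
  have mid: "P n i \<le> P (Suc n) (Suc (2 * i))" "P (Suc n) (Suc (2 * i)) \<le> P n (Suc i)" for n i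
    using P_mono[of "2 * i" "Suc (2 * i)" "Suc n"] P_mono[of "Suc (2 * i)" "2 * Suc i" "Suc n"]
    by (simp_all only: P_double) simp_all
  have small: "K * (v - u) powr \<theta> \<le> K * h n powr \<theta>" if "u \<le> v" "v - u \<le> h n" for u v n
    using that K \<theta> by (intro mult_left_mono powr_mono2) auto
  have D: "\<bar>D n i\<bar> \<le> K * h n powr \<theta>" if "i < c n t" "a \<le> t" "t \<le> b" for n i t
  proof -
    have "P n (Suc i) \<le> b" using that P_mono[of "Suc i" "c n t" n] c(1)[of t n] by simp
    then show ?thesis
      using defect[OF P_ge mid(1) mid(2), of n i] by (simp add: D_def P_Suc)
  qed
  have refine: "A (Suc n) t - A n t = (\<Sum>i<c n t. D n i) + e n t \<and> \<bar>e n t\<bar> \<le> K * h n powr \<theta>"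
    if t: "a \<le> t" "t \<le> b" for n t
  proof -
    have *: "(\<Sum>i<2 * c n t. \<mu> (P (Suc n) i) (P (Suc n) (Suc i))) - (\<Sum>i<c n t. \<mu> (P n i) (P n (Suc i)))
        = (\<Sum>i<c n t. D n i)"
      using P_double[of n "Suc _"]
      by (simp add: sum_pairs sum_subtractf[symmetric] D_def P_double)
    have Pmid: "P (Suc n) (Suc (2 * i)) = a + (real i + 1/2) * h n" for i
      by (simp add: P_def h_Suc field_simps)
    consider (l) "c (Suc n) t = 2 * c n t"
      | (r) "c (Suc n) t = Suc (2 * c n t)" "P (Suc n) (Suc (2 * c n t)) \<le> t"
      using grid_index_halve[OF h[of n] t(1)] unfolding c_def h_Suc Pmid by blast
    then show ?thesis
    proof cases
      case l
      then show ?thesis using * K by (simp add: A_def e_def P_double)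
    next
      case r
      have "\<bar>e n t\<bar> \<le> K * (t - P n (c n t)) powr \<theta>"
        using r defect[OF P_ge mid(1) r(2) t(2)] by (simp add: e_def)
      also have "\<dots> \<le> K * h n powr \<theta>"
        using c[OF t(1), of n] P_Suc[of n "c n t"] by (intro small) auto
      finally have "\<bar>e n t\<bar> \<le> K * h n powr \<theta>" .
      then show ?thesis using * r by (simp add: A_def e_def P_double)
    qed
  qed
  have incr: "\<bar>(A (Suc n) t - A (Suc n) s) - (A n t - A n s)\<bar> \<le> ((t - s) / h n + 3) * (K * h n powr \<theta>)"
    if st: "a \<le> s" "s \<le> t" "t \<le> b" for n s t
  proof -
    let ?k = "K * h n powr \<theta>"
    have cst: "c n s \<le> c n t" using grid_index_mono[OF h st(2)] by (simp add: c_def)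
    have "(\<Sum>i<c n t. D n i) - (\<Sum>i<c n s. D n i) = (\<Sum>i=c n s..<c n t. D n i)"
      using sum_diff_nat_ivl[of 0 "c n s" "c n t" "D n"] cst by (simp add: lessThan_atLeast0)
    then have "\<bar>(\<Sum>i<c n t. D n i) - (\<Sum>i<c n s. D n i)\<bar> \<le> (\<Sum>i=c n s..<c n t. \<bar>D n i\<bar>)"
      by simp
    also have "\<dots> \<le> (\<Sum>i=c n s..<c n t. ?k)" using D[of _ n t] st by (intro sum_mono) auto
    also have "\<dots> = (real (c n t) - real (c n s)) * ?k" using cst by (simp add: of_nat_diff)
    also have "\<dots> \<le> ((t - s) / h n + 1) * ?k"
      using grid_index_diff[OF h[of n] st(1,2)] K by (intro mult_right_mono) (auto simp: c_def)
    finally have "\<bar>(\<Sum>i<c n t. D n i) - (\<Sum>i<c n s. D n i)\<bar> \<le> ((t - s) / h n + 1) * ?k" .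
    moreover have "\<bar>e n t\<bar> \<le> ?k" "\<bar>e n s\<bar> \<le> ?k" using refine[of t n] refine[of s n] st by auto
    moreover have "(A (Suc n) t - A (Suc n) s) - (A n t - A n s)
        = ((\<Sum>i<c n t. D n i) - (\<Sum>i<c n s. D n i)) + e n t - e n s"
      using refine[of t n] refine[of s n] st by simp
    ultimately show ?thesis by (simp add: distrib_right abs_le_iff)
  qed
  have base: "\<bar>A n t - A n s - \<mu> s t\<bar> \<le> 2 * (K * h n powr \<theta>)"
    if st: "a \<le> s" "s \<le> t" "t \<le> b" "t - s \<le> h n" for n s t
  proof -
    let ?k = "K * h n powr \<theta>" and ?p = "P n (c n s)"
    have k: "?k \<ge> 0" using K by simp
    note cs = c[OF st(1), of n] and ct = c[of t n]
    consider (same) "c n t = c n s" | (adj) "c n t = Suc (c n s)"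
      using grid_index_adjacent[OF h st(1,2,4)] by (auto simp: c_def)
    then show ?thesis
    proof cases
      case same
      have "\<bar>\<mu> ?p s + \<mu> s t - \<mu> ?p t\<bar> \<le> K * (t - ?p) powr \<theta>"
        using cs st by (intro defect P_ge) auto
      also have "\<dots> \<le> ?k" using ct cs st same P_Suc[of n "c n t"] by (intro small) auto
      finally show ?thesis using same k by (simp add: A_def abs_le_iff)
    next
      case adj
      let ?q = "P n (Suc (c n s))"
      have q: "s \<le> ?q" "?q \<le> t" using cs ct st adj by auto
      have "\<bar>\<mu> ?p s + \<mu> s ?q - \<mu> ?p ?q\<bar> \<le> K * (?q - ?p) powr \<theta>"
        using cs st q by (intro defect P_ge) auto
      moreover have "\<bar>\<mu> s ?q + \<mu> ?q t - \<mu> s t\<bar> \<le> K * (t - s) powr \<theta>"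
        using st q by (intro defect) auto
      moreover have "K * (t - s) powr \<theta> \<le> ?k" using st by (intro small)
      ultimately show ?thesis using adj by (simp add: A_def P_Suc abs_le_iff)
    qed
  qed

  define \<rho> where "\<rho> = (2::real) powr (1 - \<theta>)"
  have \<rho>: "0 \<le> \<rho>" "\<rho> < 1" using \<theta> powr_less_cancel_iff[of 2 "1 - \<theta>" 0] by (auto simp: \<rho>_def)
  have limit: "\<exists>l. (\<lambda>m. A (N + m) t - A (N + m) s) \<longlonglongrightarrow> l \<and>
      \<bar>l - (A N t - A N s)\<bar> \<le> 4 * K * h N powr \<theta> / (1 - \<rho>)"
    if st: "a \<le> s" "s \<le> t" "t \<le> b" "t - s \<le> h N" for N s t
  proof -
    let ?x = "\<lambda>m. A (N + m) t - A (N + m) s"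
    have "\<bar>?x (Suc m) - ?x m\<bar> \<le> 4 * K * h N powr \<theta> * \<rho> ^ m" for m
    proof -
      have hm: "h (N + m) = h N / 2 ^ m" by (simp add: h_def power_add)
      have "(t - s) / h (N + m) = 2 ^ m * ((t - s) / h N)" by (simp add: hm)
      also have "\<dots> \<le> 2 ^ m * 1" using st(4) h[of N] by (intro mult_left_mono) auto
      finally have "(t - s) / h (N + m) + 3 \<le> 4 * 2 ^ m"
        using one_le_power[of "2::real" m] by linarith
      then have le: "((t - s) / h (N + m) + 3) * (K * h (N + m) powr \<theta>)
          \<le> 4 * 2 ^ m * (K * h (N + m) powr \<theta>)"
        using K by (intro mult_right_mono) auto
      have hp: "h (N + m) powr \<theta> = h N powr \<theta> / (2 ^ m) powr \<theta>"
        using h[of N] by (simp add: hm powr_divide)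
      have "\<bar>?x (Suc m) - ?x m\<bar> \<le> 4 * 2 ^ m * (K * h (N + m) powr \<theta>)"
        using incr[OF st(1-3), of "N + m"] le by simp
      also have "\<dots> = 4 * K * h N powr \<theta> * (2 ^ m / (2 ^ m) powr \<theta>)" by (simp add: hp)
      also have "(2::real) ^ m / (2 ^ m) powr \<theta> = \<rho> ^ m"
        by (simp add: \<rho>_def powr_realpow[symmetric] powr_powr powr_diff[symmetric] algebra_simps)
      finally show ?thesis .
    qed
    then show ?thesis
    proof (rule geometric_increments_limit[OF _ \<rho>])
      fix l assume "?x \<longlonglongrightarrow> l" "\<And>n. \<bar>l - ?x n\<bar> \<le> 4 * K * h N powr \<theta> * \<rho> ^ n / (1 - \<rho>)"
      from this(1) this(2)[of 0] show ?thesis by (intro exI[of _ l]) auto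
    qed
  qed
  define J where "J t = lim (\<lambda>n. A n t)" for t
  have J: "(\<lambda>n. A n t) \<longlonglongrightarrow> J t" if "a \<le> t" "t \<le> b" for t
  proof -
    have "t - a \<le> h 0" using that by (simp add: h_def)
    from limit[OF order_refl that this] have "convergent (\<lambda>n. A n t)"
      by (auto simp: A_a convergent_def)
    then show ?thesis by (simp add: J_def convergent_LIMSEQ_iff)
  qed
  show ?thesis
  proof (rule that)
    show "J a = 0" using J[of a] ab by (simp add: A_a LIMSEQ_const_iff)
    fix s t assume st: "a \<le> s" "s \<le> t" "t \<le> b"
    show "\<bar>J t - J s - \<mu> s t\<bar> \<le> sewing_const \<theta> * K * (t - s) powr \<theta>"
    proof (cases "s = t")
      case True
      then show ?thesis using \<mu>0[of t] st by simp
    next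
      case False
      then obtain N where N: "(b - a) / 2 ^ Suc N < t - s" "t - s \<le> (b - a) / 2 ^ N"
        using dyadic_scale[of "t - s" "b - a"] st by auto
      then have N: "h N \<le> 2 * (t - s)" "t - s \<le> h N" by (auto simp: h_def field_simps)
      obtain l where l: "(\<lambda>m. A (N + m) t - A (N + m) s) \<longlonglongrightarrow> l"
        "\<bar>l - (A N t - A N s)\<bar> \<le> 4 * K * h N powr \<theta> / (1 - \<rho>)"
        using limit[OF st N(2)] by blast
      have "(\<lambda>n. A n t - A n s) \<longlonglongrightarrow> J t - J s" using st by (intro tendsto_diff J) auto
      then have "(\<lambda>m. A (N + m) t - A (N + m) s) \<longlonglongrightarrow> J t - J s"
        using LIMSEQ_ignore_initial_segment[of "\<lambda>n. A n t - A n s" _ N] by (simp add: add.commute)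
      with l(1) have "l = J t - J s" by (rule LIMSEQ_unique)
      with l(2) base[OF st N(2)]
      have "\<bar>J t - J s - \<mu> s t\<bar> \<le> 4 * K * h N powr \<theta> / (1 - \<rho>) + 2 * (K * h N powr \<theta>)"
        by (simp add: abs_le_iff)
      also have "\<dots> = (2 + 4 / (1 - \<rho>)) * K * h N powr \<theta>" by (simp add: algebra_simps)
      also have "\<dots> \<le> (2 + 4 / (1 - \<rho>)) * K * (2 * (t - s)) powr \<theta>"
        using N h[of N] \<theta> \<rho> K by (intro mult_left_mono powr_mono2) auto
      also have "\<dots> = sewing_const \<theta> * K * (t - s) powr \<theta>"
        using st powr_mult[of 2 "t - s" \<theta>] by (simp only: sewing_const_def \<rho>_def) simp
      finally show ?thesis .
    qed
  qed
qed



section \<open>Stieltjes integrals of Hoelder functions\<close>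

lemma partition_mono:
  fixes p :: "nat \<Rightarrow> real"
  assumes "\<And>i. i < n \<Longrightarrow> p i \<le> p (Suc i)" "i \<le> j" "j \<le> n"
  shows "p i \<le> p j"
  using assms(2,3)
proof (induction j rule: dec_induct)
  case (step k)
  then show ?case using assms(1)[of k] by simp
qed simp

text \<open>
  The definition quantifies over all sufficiently fine partitions; equidistant ones show that it
  is not vacuous, which is what makes the value unique.
\<close>

lemma has_stieltjes_integral_unique:
  assumes y: "has_stieltjes_integral f g a b y" and z: "has_stieltjes_integral f g a b z"
    and "a \<le> b"
  shows "y = z"
proof (rule ccontr)
  assume "y \<noteq> z"
  then have \<epsilon>: "\<bar>y - z\<bar> / 2 > 0" by simp
  obtain \<delta>1 where \<delta>1: "\<delta>1 > 0" "\<And>n p u. p 0 = a \<and> p n = b \<and>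
      (\<forall>i<n. p i \<le> p (Suc i) \<and> p (Suc i) - p i < \<delta>1 \<and> u i \<in> {p i..p (Suc i)}) \<Longrightarrow>
      \<bar>(\<Sum>i<n. f (u i) * (g (p (Suc i)) - g (p i))) - y\<bar> < \<bar>y - z\<bar> / 2"
    using y \<epsilon> unfolding has_stieltjes_integral_def by meson
  obtain \<delta>2 where \<delta>2: "\<delta>2 > 0" "\<And>n p u. p 0 = a \<and> p n = b \<and>
      (\<forall>i<n. p i \<le> p (Suc i) \<and> p (Suc i) - p i < \<delta>2 \<and> u i \<in> {p i..p (Suc i)}) \<Longrightarrow>
      \<bar>(\<Sum>i<n. f (u i) * (g (p (Suc i)) - g (p i))) - z\<bar> < \<bar>y - z\<bar> / 2"
    using z \<epsilon> unfolding has_stieltjes_integral_def by meson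
  define \<delta> where "\<delta> = min \<delta>1 \<delta>2"
  have \<delta>: "\<delta> > 0" using \<delta>1 \<delta>2 by (simp add: \<delta>_def)
  obtain m where m: "(b - a) / \<delta> < real m" using reals_Archimedean2 by blast
  define n where "n = Suc m"
  define p where "p i = a + real i * ((b - a) / real n)" for i
  have mesh: "p (Suc i) - p i = (b - a) / real n" for i by (simp add: p_def add_divide_distrib distrib_right)
  have "(b - a) / \<delta> < real n" using m by (simp add: n_def)
  then have "(b - a) / real n < \<delta>" using \<delta> by (simp add: n_def field_simps)
  moreover have "0 \<le> (b - a) / real n" using \<open>a \<le> b\<close> by simp
  ultimately have "p i \<le> p (Suc i) \<and> p (Suc i) - p i < \<delta> \<and> p i \<in> {p i..p (Suc i)}" for i
    using mesh[of i] by auto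
  moreover have "p 0 = a" "p n = b" by (auto simp: p_def n_def)
  ultimately have "\<bar>(\<Sum>i<n. f (p i) * (g (p (Suc i)) - g (p i))) - y\<bar> < \<bar>y - z\<bar> / 2"
    "\<bar>(\<Sum>i<n. f (p i) * (g (p (Suc i)) - g (p i))) - z\<bar> < \<bar>y - z\<bar> / 2"
    using \<delta>1(2)[of p n p] \<delta>2(2)[of p n p] by (auto simp: \<delta>_def)
  moreover have "\<bar>y - z\<bar> \<le> \<bar>x - y\<bar> + \<bar>x - z\<bar>" for x by linarith
  ultimately have "\<bar>y - z\<bar> < \<bar>y - z\<bar> / 2 + \<bar>y - z\<bar> / 2"
    by (meson add_strict_mono order_le_less_trans)
  then show False by simp
qed

lemma has_stieltjes_integral_cong:
  assumes "\<And>x. x \<in> {a..b} \<Longrightarrow> f x = f' x"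
  shows "has_stieltjes_integral f g a b y \<longleftrightarrow> has_stieltjes_integral f' g a b y"
proof -
  have "has_stieltjes_integral f' g a b y"
    if h: "has_stieltjes_integral f g a b y" and eq: "\<And>x. x \<in> {a..b} \<Longrightarrow> f x = f' x" for f f'
    unfolding has_stieltjes_integral_def
  proof (intro allI impI)
    fix \<epsilon> :: real assume "\<epsilon> > 0"
    then obtain \<delta> where \<delta>: "\<delta> > 0" "\<And>n p u. p 0 = a \<and> p n = b \<and>
        (\<forall>i<n. p i \<le> p (Suc i) \<and> p (Suc i) - p i < \<delta> \<and> u i \<in> {p i..p (Suc i)}) \<Longrightarrow>
        \<bar>(\<Sum>i<n. f (u i) * (g (p (Suc i)) - g (p i))) - y\<bar> < \<epsilon>"
      using h unfolding has_stieltjes_integral_def by meson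
    show "\<exists>\<delta>>0. \<forall>n p u. p 0 = a \<and> p n = b \<and>
        (\<forall>i<n. p i \<le> p (Suc i) \<and> p (Suc i) - p i < \<delta> \<and> u i \<in> {p i..p (Suc i)}) \<longrightarrow>
        \<bar>(\<Sum>i<n. f' (u i) * (g (p (Suc i)) - g (p i))) - y\<bar> < \<epsilon>"
    proof (intro exI[of _ \<delta>] conjI allI impI)
      fix n p u
      assume pu: "p 0 = a \<and> p n = b \<and>
        (\<forall>i<n. p i \<le> p (Suc i) \<and> p (Suc i) - p i < \<delta> \<and> u i \<in> {p i..p (Suc i)})"
      have "f (u i) = f' (u i)" if "i < n" for i
      proof (rule eq)
        have "p 0 \<le> p i" "p (Suc i) \<le> p n" using pu that by (auto intro: partition_mono[of n])
        then show "u i \<in> {a..b}" using pu that by force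
      qed
      then show "\<bar>(\<Sum>i<n. f' (u i) * (g (p (Suc i)) - g (p i))) - y\<bar> < \<epsilon>"
        using \<delta>(2)[OF pu] by simp
    qed (rule \<delta>(1))
  qed
  from this[of f f'] this[of f' f] assms show ?thesis by auto
qed

lemma has_stieltjes_integral_diff:
  assumes y: "has_stieltjes_integral f g a b y" and z: "has_stieltjes_integral f' g a b z"
  shows "has_stieltjes_integral (\<lambda>x. f x - f' x) g a b (y - z)"
  unfolding has_stieltjes_integral_def
proof (intro allI impI)
  fix \<epsilon> :: real assume "\<epsilon> > 0"
  then have \<epsilon>: "\<epsilon> / 2 > 0" by simp
  obtain \<delta>1 where \<delta>1: "\<delta>1 > 0" "\<And>n p u. p 0 = a \<and> p n = b \<and>
      (\<forall>i<n. p i \<le> p (Suc i) \<and> p (Suc i) - p i < \<delta>1 \<and> u i \<in> {p i..p (Suc i)}) \<Longrightarrow>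
      \<bar>(\<Sum>i<n. f (u i) * (g (p (Suc i)) - g (p i))) - y\<bar> < \<epsilon> / 2"
    using y \<epsilon> unfolding has_stieltjes_integral_def by meson
  obtain \<delta>2 where \<delta>2: "\<delta>2 > 0" "\<And>n p u. p 0 = a \<and> p n = b \<and>
      (\<forall>i<n. p i \<le> p (Suc i) \<and> p (Suc i) - p i < \<delta>2 \<and> u i \<in> {p i..p (Suc i)}) \<Longrightarrow>
      \<bar>(\<Sum>i<n. f' (u i) * (g (p (Suc i)) - g (p i))) - z\<bar> < \<epsilon> / 2"
    using z \<epsilon> unfolding has_stieltjes_integral_def by meson
  show "\<exists>\<delta>>0. \<forall>n p u. p 0 = a \<and> p n = b \<and>
      (\<forall>i<n. p i \<le> p (Suc i) \<and> p (Suc i) - p i < \<delta> \<and> u i \<in> {p i..p (Suc i)}) \<longrightarrow>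
      \<bar>(\<Sum>i<n. (f (u i) - f' (u i)) * (g (p (Suc i)) - g (p i))) - (y - z)\<bar> < \<epsilon>"
  proof (intro exI[of _ "min \<delta>1 \<delta>2"] conjI allI impI)
    fix n p u
    assume pu: "p 0 = a \<and> p n = b \<and> (\<forall>i<n. p i \<le> p (Suc i) \<and>
      p (Suc i) - p i < min \<delta>1 \<delta>2 \<and> u i \<in> {p i..p (Suc i)})"
    have "\<bar>(\<Sum>i<n. f (u i) * (g (p (Suc i)) - g (p i))) - y\<bar> < \<epsilon> / 2"
      "\<bar>(\<Sum>i<n. f' (u i) * (g (p (Suc i)) - g (p i))) - z\<bar> < \<epsilon> / 2"
      using \<delta>1(2)[of p n u] \<delta>2(2)[of p n u] pu by auto
    then show "\<bar>(\<Sum>i<n. (f (u i) - f' (u i)) * (g (p (Suc i)) - g (p i))) - (y - z)\<bar> < \<epsilon>"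
      unfolding left_diff_distrib sum_subtractf by linarith
  qed (use \<delta>1 \<delta>2 in auto)
qed

text \<open>
  Each summand of a Riemann sum differs from an increment of \<open>J\<close> by at most
  \<open>C (v-u)\<^bsup>\<theta>\<^esup> \<le> C \<delta>\<^bsup>\<theta>-1\<^esup> (v-u)\<close> when the mesh is below \<open>\<delta>\<close>; the increments of \<open>J\<close> telescope and
  the errors add up to at most \<open>C \<delta>\<^bsup>\<theta>-1\<^esup> (t-s)\<close>, for all partitions and tags at once.
\<close>

lemma has_stieltjes_integral_of_almost_additive:
  assumes "C \<ge> 0" "\<theta> > 1" "s \<le> t"
    and approx: "\<And>u v r. s \<le> u \<Longrightarrow> u \<le> r \<Longrightarrow> r \<le> v \<Longrightarrow> v \<le> t \<Longrightarrow>
      \<bar>f r * (g v - g u) - (J v - J u)\<bar> \<le> C * (v - u) powr \<theta>"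
  shows "has_stieltjes_integral f g s t (J t - J s)"
  unfolding has_stieltjes_integral_def
proof (intro allI impI)
  fix \<epsilon> :: real assume \<epsilon>: "\<epsilon> > 0"
  \<comment> \<open>The summand 1 keeps \<open>q\<close> positive; \<open>\<delta>\<close> is chosen such that \<open>C \<delta>\<^bsup>\<theta>-1\<^esup> (t-s) < \<epsilon>\<close>.\<close>
  define q where "q = C * (t - s) + 1"
  have q: "q > 0" using assms by (simp add: q_def add_nonneg_pos)
  define \<delta> where "\<delta> = (\<epsilon> / q) powr (1 / (\<theta> - 1))"
  have \<delta>: "\<delta> > 0" "\<delta> powr (\<theta> - 1) = \<epsilon> / q"
    using \<epsilon> q \<open>\<theta> > 1\<close> by (auto simp: \<delta>_def powr_powr)
  show "\<exists>\<delta>>0. \<forall>n p u. p 0 = s \<and> p n = t \<and>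
      (\<forall>i<n. p i \<le> p (Suc i) \<and> p (Suc i) - p i < \<delta> \<and> u i \<in> {p i..p (Suc i)}) \<longrightarrow>
      \<bar>(\<Sum>i<n. f (u i) * (g (p (Suc i)) - g (p i))) - (J t - J s)\<bar> < \<epsilon>"
  proof (intro exI[of _ \<delta>] conjI allI impI)
    fix n :: nat and p u :: "nat \<Rightarrow> real"
    assume pu: "p 0 = s \<and> p n = t \<and>
      (\<forall>i<n. p i \<le> p (Suc i) \<and> p (Suc i) - p i < \<delta> \<and> u i \<in> {p i..p (Suc i)})"
    have each: "\<bar>f (u i) * (g (p (Suc i)) - g (p i)) - (J (p (Suc i)) - J (p i))\<bar>
        \<le> C * (\<epsilon> / q) * (p (Suc i) - p i)" if i: "i < n" for i
    proof -
      have bounds: "s \<le> p i" "p (Suc i) \<le> t"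
        using partition_mono[of n p 0 i] partition_mono[of n p "Suc i" n] pu i by auto
      have "\<bar>f (u i) * (g (p (Suc i)) - g (p i)) - (J (p (Suc i)) - J (p i))\<bar>
          \<le> C * (p (Suc i) - p i) powr \<theta>"
        using bounds pu i by (intro approx) auto
      also have "(p (Suc i) - p i) powr \<theta> = (p (Suc i) - p i) powr (\<theta> - 1) * (p (Suc i) - p i)"
        using pu i powr_add[of "p (Suc i) - p i" "\<theta> - 1" 1] by simp
      also have "C * \<dots> \<le> C * (\<delta> powr (\<theta> - 1) * (p (Suc i) - p i))"
        using pu i \<open>\<theta> > 1\<close> \<open>C \<ge> 0\<close>
        by (intro mult_left_mono mult_right_mono powr_mono2) (auto simp: less_imp_le)
      finally show ?thesis by (simp add: \<delta>)
    qed
    have tel: "(\<Sum>i<n. J (p (Suc i)) - J (p i)) = J t - J s" "(\<Sum>i<n. p (Suc i) - p i) = t - s"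
      using pu by (simp_all add: sum_lessThan_telescope[of "\<lambda>i. J (p i)"] sum_lessThan_telescope[of p])
    have "\<bar>(\<Sum>i<n. f (u i) * (g (p (Suc i)) - g (p i))) - (J t - J s)\<bar>
        = \<bar>\<Sum>i<n. f (u i) * (g (p (Suc i)) - g (p i)) - (J (p (Suc i)) - J (p i))\<bar>"
      by (simp add: sum_subtractf[where g = "\<lambda>i. J (p (Suc i)) - J (p i)"] tel(1))
    also have "\<dots> \<le> (\<Sum>i<n. C * (\<epsilon> / q) * (p (Suc i) - p i))"
      by (rule order_trans[OF sum_abs sum_mono]) (use each in auto)
    also have "\<dots> = C * (\<epsilon> / q) * (t - s)" by (simp only: sum_distrib_left[symmetric] tel(2))
    also have "\<dots> = \<epsilon> * (C * (t - s) / q)" by simp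
    also have "\<dots> < \<epsilon> * 1"
      using \<epsilon> q by (intro mult_strict_left_mono) (auto simp: q_def)
    finally show "\<bar>(\<Sum>i<n. f (u i) * (g (p (Suc i)) - g (p i))) - (J t - J s)\<bar> < \<epsilon>" by simp
  qed (rule \<delta>(1))
qed

definition stieltjes :: "(real \<Rightarrow> real) \<Rightarrow> (real \<Rightarrow> real) \<Rightarrow> real \<Rightarrow> real \<Rightarrow> real" where
  "stieltjes f g a b = (THE y. has_stieltjes_integral f g a b y)"

lemma stieltjes_eq:
  "has_stieltjes_integral f g a b y \<Longrightarrow> a \<le> b \<Longrightarrow> stieltjes f g a b = y"
  unfolding stieltjes_def by (blast intro: the_equality has_stieltjes_integral_unique)

lemma stieltjes_cong:
  assumes "\<And>x. x \<in> {a..b} \<Longrightarrow> f x = f' x"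
  shows "stieltjes f g a b = stieltjes f' g a b"
proof -
  have "has_stieltjes_integral f g a b = has_stieltjes_integral f' g a b"
    using assms by (intro ext has_stieltjes_integral_cong) auto
  then show ?thesis by (simp add: stieltjes_def)
qed

text \<open>
  The one-point approximation \<open>\<mu> s t = f s * (g t - g s)\<close> has defect
  \<open>(f u - f s) * (g t - g u)\<close>, which is \<open>O((t-s)\<^bsup>\<beta>+\<gamma>\<^esup>)\<close>, so that sewing applies. The constants
  refer to the interval \<open>[a,b]\<close> alone; on short intervals the local Hoelder constant of \<open>f\<close> may
  therefore be used.
\<close>

theorem young_integral:
  assumes ab: "a \<le> b"
    and f: "holder_bound \<beta> K {a..b} f" and g: "holder_bound \<gamma> G {a..b} g"
    and exps: "\<beta> > 0" "\<gamma> > 0" "\<beta> + \<gamma> > 1" and KG: "K \<ge> 0" "G \<ge> 0"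
  obtains J where "J a = 0"
    "\<And>s t. a \<le> s \<Longrightarrow> s \<le> t \<Longrightarrow> t \<le> b \<Longrightarrow> has_stieltjes_integral f g s t (J t - J s)"
    "\<And>s t. a \<le> s \<Longrightarrow> s \<le> t \<Longrightarrow> t \<le> b \<Longrightarrow>
      \<bar>J t - J s - f s * (g t - g s)\<bar> \<le> sewing_const (\<beta> + \<gamma>) * K * G * (t - s) powr (\<beta> + \<gamma>)"
proof -
  let ?\<theta> = "\<beta> + \<gamma>" and ?C = "sewing_const (\<beta> + \<gamma>)"
  have prod: "\<bar>(f r - f u) * (g w - g v)\<bar> \<le> K * G * (t - s) powr ?\<theta>"
    if "a \<le> s" "s \<le> u" "u \<le> r" "r \<le> t" "s \<le> v" "v \<le> w" "w \<le> t" "t \<le> b" for s t u r v w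
  proof -
    have "\<bar>f r - f u\<bar> \<le> K * \<bar>r - u\<bar> powr \<beta>" using f that by (intro holder_boundD) auto
    also have "\<dots> \<le> K * (t - s) powr \<beta>"
      using that exps KG by (intro mult_left_mono powr_mono2) auto
    finally have 1: "\<bar>f r - f u\<bar> \<le> K * (t - s) powr \<beta>" .
    have "\<bar>g w - g v\<bar> \<le> G * \<bar>w - v\<bar> powr \<gamma>" using g that by (intro holder_boundD) auto
    also have "\<dots> \<le> G * (t - s) powr \<gamma>"
      using that exps KG by (intro mult_left_mono powr_mono2) auto
    finally have 2: "\<bar>g w - g v\<bar> \<le> G * (t - s) powr \<gamma>" .
    have "\<bar>(f r - f u) * (g w - g v)\<bar> \<le> (K * (t - s) powr \<beta>) * (G * (t - s) powr \<gamma>)"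
      unfolding abs_mult using KG by (intro mult_mono 1 2) auto
    then show ?thesis by (simp add: powr_add mult_ac)
  qed
  have defect: "\<bar>f s * (g u - g s) + f u * (g t - g u) - f s * (g t - g s)\<bar> \<le> (K * G) * (t - s) powr ?\<theta>"
    if "a \<le> s" "s \<le> u" "u \<le> t" "t \<le> b" for s u t
    using prod[of s s u t u t] that by (simp add: algebra_simps)
  have "K * G \<ge> 0" using KG by simp
  then show ?thesis
  proof (rule sewing[OF ab exps(3) _ defect])
    fix J assume J: "J a = 0"
      "\<And>s t. a \<le> s \<Longrightarrow> s \<le> t \<Longrightarrow> t \<le> b \<Longrightarrow>
        \<bar>J t - J s - f s * (g t - g s)\<bar> \<le> ?C * (K * G) * (t - s) powr ?\<theta>"
    show ?thesis
    proof (rule that[of J])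
      show "J a = 0" by (rule J(1))
      fix s t assume st: "a \<le> s" "s \<le> t" "t \<le> b"
      show "\<bar>J t - J s - f s * (g t - g s)\<bar> \<le> ?C * K * G * (t - s) powr ?\<theta>"
        using J(2)[OF st] by (simp add: mult.assoc)
      show "has_stieltjes_integral f g s t (J t - J s)"
      proof (rule has_stieltjes_integral_of_almost_additive)
        fix u v r assume uvr: "s \<le> u" "u \<le> r" "r \<le> v" "v \<le> t"
        have "\<bar>(f r - f u) * (g v - g u)\<bar> \<le> K * G * (v - u) powr ?\<theta>"
          using uvr st by (intro prod) auto
        moreover have "f r * (g v - g u) - (J v - J u)
            = (f r - f u) * (g v - g u) - (J v - J u - f u * (g v - g u))"
          by (simp add: algebra_simps)
        ultimately show "\<bar>f r * (g v - g u) - (J v - J u)\<bar> \<le> (?C + 1) * (K * G) * (v - u) powr ?\<theta>"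
          using J(2)[of u v] uvr st by (simp add: distrib_right)
      qed (use st exps KG in \<open>auto simp: sewing_const_nonneg\<close>)
    qed
  qed
qed

context
  fixes a b \<beta> \<gamma> K G :: real and f g :: "real \<Rightarrow> real"
  assumes f: "holder_bound \<beta> K {a..b} f" and g: "holder_bound \<gamma> G {a..b} g"
    and exps: "\<beta> > 0" "\<gamma> > 0" "\<beta> + \<gamma> > 1" and KG: "K \<ge> 0" "G \<ge> 0"
begin

lemma has_stieltjes_integral_stieltjes:
  assumes "a \<le> s" "s \<le> t" "t \<le> b"
  shows "has_stieltjes_integral f g s t (stieltjes f g s t)"
proof -
  from assms have "a \<le> b" by linarith
  then show ?thesis
  proof (rule young_integral[OF _ f g exps KG])
    fix J assume "\<And>s t. a \<le> s \<Longrightarrow> s \<le> t \<Longrightarrow> t \<le> b \<Longrightarrow> has_stieltjes_integral f g s t (J t - J s)"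
    from this[OF assms] show ?thesis using stieltjes_eq assms(2) by simp
  qed
qed

lemma stieltjes_combine:
  assumes "a \<le> s" "s \<le> t" "t \<le> u" "u \<le> b"
  shows "stieltjes f g s t + stieltjes f g t u = stieltjes f g s u"
proof -
  from assms have "a \<le> b" by linarith
  then show ?thesis
  proof (rule young_integral[OF _ f g exps KG])
    fix J assume J: "\<And>s t. a \<le> s \<Longrightarrow> s \<le> t \<Longrightarrow> t \<le> b \<Longrightarrow> has_stieltjes_integral f g s t (J t - J s)"
    have "stieltjes f g v w = J w - J v" if "a \<le> v" "v \<le> w" "w \<le> b" for v w
      using stieltjes_eq[OF J[OF that]] that by simp
    from this[of s t] this[of t u] this[of s u] show ?thesis using assms by simp
  qed
qed

lemma stieltjes_estimate:
  assumes "a \<le> s" "s \<le> t" "t \<le> b"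
  shows "\<bar>stieltjes f g s t - f s * (g t - g s)\<bar>
    \<le> sewing_const (\<beta> + \<gamma>) * K * G * (t - s) powr (\<beta> + \<gamma>)"
proof -
  from assms have "a \<le> b" by linarith
  then show ?thesis
  proof (rule young_integral[OF _ f g exps KG])
    fix J assume J:
      "\<And>s t. a \<le> s \<Longrightarrow> s \<le> t \<Longrightarrow> t \<le> b \<Longrightarrow> has_stieltjes_integral f g s t (J t - J s)"
      "\<And>s t. a \<le> s \<Longrightarrow> s \<le> t \<Longrightarrow> t \<le> b \<Longrightarrow>
        \<bar>J t - J s - f s * (g t - g s)\<bar> \<le> sewing_const (\<beta> + \<gamma>) * K * G * (t - s) powr (\<beta> + \<gamma>)"
    show ?thesis using J(2)[OF assms] stieltjes_eq[OF J(1)[OF assms] assms(2)] by simp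
  qed
qed

end

lemma stieltjes_self: "stieltjes f g a a = 0"
proof (rule stieltjes_eq)
  have "f r * (g v - g u) = 0" if "a \<le> u" "u \<le> r" "r \<le> v" "v \<le> a" for u v r
  proof -
    have "v = u" using that by linarith
    then show ?thesis by simp
  qed
  then show "has_stieltjes_integral f g a a 0"
    using has_stieltjes_integral_of_almost_additive[of 0 2 a a f g "\<lambda>_. 0"] by simp
qed simp

section \<open>Equations driven by a Hoelder path\<close>

text \<open>
  The diffusion coefficient is used through its Lipschitz bound and through the bound on its
  second differences, which is what differentiability in \<open>x\<close> with a Lipschitz derivative provides.
\<close>

locale rough_equation =
  fixes T \<beta> \<gamma> G L :: real and g :: "real \<Rightarrow> real" and b \<sigma> :: "real \<Rightarrow> real \<Rightarrow> real"
  assumes T: "T > 0" and \<beta>: "0 < \<beta>" "\<beta> < \<gamma>" and \<gamma>: "\<gamma> < 1" and \<beta>\<gamma>: "\<beta> + \<gamma> > 1"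
    and G: "G \<ge> 0" and g: "holder_bound \<gamma> G {0..T} g" and L: "L \<ge> 0"
    and b_lipschitz: "\<And>s t x y. s \<ge> 0 \<Longrightarrow> t \<ge> 0 \<Longrightarrow>
      \<bar>b t x - b s y\<bar> \<le> L * (\<bar>t - s\<bar> + \<bar>x - y\<bar>)"
    and \<sigma>_lipschitz: "\<And>s t x y. s \<ge> 0 \<Longrightarrow> t \<ge> 0 \<Longrightarrow>
      \<bar>\<sigma> t x - \<sigma> s y\<bar> \<le> L * (\<bar>t - s\<bar> + \<bar>x - y\<bar>)"
    and \<sigma>_second_difference: "\<And>s t x y x' y'. s \<ge> 0 \<Longrightarrow> t \<ge> 0 \<Longrightarrow>
      \<bar>(\<sigma> t x - \<sigma> t y) - (\<sigma> s x' - \<sigma> s y')\<bar>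
        \<le> L * (\<bar>(x - y) - (x' - y')\<bar> + \<bar>x' - y'\<bar> * (\<bar>t - s\<bar> + \<bar>x - x'\<bar> + \<bar>y - y'\<bar>))"
begin

text \<open>
  A constant absorbing all comparisons of powers: on \<open>[0,T]\<close> a power may be traded for one with an
  exponent smaller by at most 1 at the cost of a factor \<open>W\<close>, also if \<open>T > 1\<close>.
\<close>

definition W :: real where "W = 1 + T"

lemma W: "W \<ge> 1" "W > 0" using T by (simp_all add: W_def)

lemma powr_le_W:
  assumes "0 \<le> d" "d \<le> T" "0 \<le> e" "e \<le> 1"
  shows "d powr e \<le> W"
proof -
  have "d powr e \<le> W powr e" using assms by (intro powr_mono2) (auto simp: W_def)
  also have "\<dots> \<le> W powr 1" using W assms by (intro powr_mono) auto
  finally show ?thesis using W by simp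
qed

lemma powr_le_W_powr:
  assumes "0 \<le> d" "d \<le> T" "q \<le> p" "p \<le> q + 1"
  shows "d powr p \<le> W * d powr q"
proof -
  have "d powr p = d powr (p - q) * d powr q" using powr_add[of d "p - q" q] by simp
  also have "\<dots> \<le> W * d powr q" using assms by (intro mult_right_mono powr_le_W) auto
  finally show ?thesis .
qed

lemma self_le_W_powr:
  assumes "0 \<le> d" "d \<le> T" "0 \<le> q" "q \<le> 1"
  shows "d \<le> W * d powr q"
  using powr_le_W_powr[of d q 1] assms by simp

lemma holder_bound_from_start:
  assumes X: "holder_bound \<beta> K {a..c} X" and "0 \<le> a" "c \<le> T" "r \<in> {a..c}" "K \<ge> 0"
  shows "\<bar>X r - X a\<bar> \<le> K * W"
proof -
  have "\<bar>X r - X a\<bar> \<le> K * \<bar>r - a\<bar> powr \<beta>" using assms by (intro holder_boundD) auto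
  also have "\<dots> \<le> K * W" using assms \<beta> \<gamma> by (intro mult_left_mono powr_le_W) auto
  finally show ?thesis .
qed

lemma holder_bound_compose:
  assumes lip: "\<And>s t x y. s \<ge> 0 \<Longrightarrow> t \<ge> 0 \<Longrightarrow> \<bar>f t x - f s y\<bar> \<le> L * (\<bar>t - s\<bar> + \<bar>x - y\<bar>)"
    and X: "holder_bound \<beta> K {a..c} X" and ac: "0 \<le> a" "c \<le> T"
  shows "holder_bound \<beta> (L * (W + K)) {a..c} (\<lambda>t. f t (X t))"
  unfolding holder_bound_def
proof (intro ballI)
  fix s t assume st: "s \<in> {a..c}" "t \<in> {a..c}"
  have "\<bar>f s (X s) - f t (X t)\<bar> \<le> L * (\<bar>s - t\<bar> + \<bar>X s - X t\<bar>)" using st ac by (intro lip) auto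
  also have "\<dots> \<le> L * (W * \<bar>s - t\<bar> powr \<beta> + K * \<bar>s - t\<bar> powr \<beta>)"
    using st ac \<beta> \<gamma> L by (intro mult_left_mono add_mono self_le_W_powr holder_boundD[OF X]) auto
  finally show "\<bar>f s (X s) - f t (X t)\<bar> \<le> L * (W + K) * \<bar>s - t\<bar> powr \<beta>"
    by (simp add: algebra_simps)
qed

definition solution_map :: "real \<Rightarrow> (real \<Rightarrow> real) \<Rightarrow> real \<Rightarrow> real" where
  "solution_map z X t =
    z + integral {0..t} (\<lambda>\<tau>. b \<tau> (X \<tau>)) + stieltjes (\<lambda>\<tau>. \<sigma> \<tau> (X \<tau>)) g 0 t"

lemma solution_map_0: "solution_map z X 0 = z"
  by (simp add: solution_map_def stieltjes_self)

text \<open>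
  Causality: the value at \<open>t\<close> depends on the path up to time \<open>t\<close> only.
\<close>

lemma solution_map_cong:
  assumes "\<And>s. 0 \<le> s \<Longrightarrow> s \<le> t \<Longrightarrow> X s = Y s"
  shows "solution_map z X t = solution_map z Y t"
proof -
  have "integral {0..t} (\<lambda>\<tau>. b \<tau> (X \<tau>)) = integral {0..t} (\<lambda>\<tau>. b \<tau> (Y \<tau>))"
    using assms by (intro integral_cong) auto
  moreover have "stieltjes (\<lambda>\<tau>. \<sigma> \<tau> (X \<tau>)) g 0 t = stieltjes (\<lambda>\<tau>. \<sigma> \<tau> (Y \<tau>)) g 0 t"
    using assms by (intro stieltjes_cong) auto
  ultimately show ?thesis by (simp add: solution_map_def)
qed

definition holder_path :: "(real \<Rightarrow> real) \<Rightarrow> bool" where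
  "holder_path X \<longleftrightarrow> (\<exists>K. holder_bound \<beta> K {0..T} X)"

lemma holder_pathE:
  assumes "holder_path X"
  obtains K where "K \<ge> 0" "holder_bound \<beta> K {0..T} X"
  using assms holder_bound_nonneg unfolding holder_path_def by metis

lemma drift_continuous:
  assumes "holder_path X"
  shows "continuous_on {0..T} (\<lambda>t. b t (X t))"
proof -
  from assms obtain K where "holder_bound \<beta> K {0..T} X" by (rule holder_pathE)
  from holder_bound_compose[OF b_lipschitz this] show ?thesis
    using \<beta>(1) by (intro holder_bound_continuous_on) auto
qed

lemma drift_integrable:
  assumes "holder_path X" "0 \<le> s" "t \<le> T"
  shows "(\<lambda>t. b t (X t)) integrable_on {s..t}"
  using assms by (intro integrable_continuous_real continuous_on_subset[OF drift_continuous]) auto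

lemma diffusion_holder:
  assumes "holder_path X"
  obtains K where "K \<ge> 0" "holder_bound \<beta> K {0..T} (\<lambda>t. \<sigma> t (X t))"
proof -
  from assms obtain K where K: "K \<ge> 0" "holder_bound \<beta> K {0..T} X" by (rule holder_pathE)
  from holder_bound_compose[OF \<sigma>_lipschitz K(2)] K(1) W L show ?thesis
    by (intro that[of "L * (W + K)"]) auto
qed

lemma solution_map_increment:
  assumes X: "holder_path X" and st: "0 \<le> s" "s \<le> t" "t \<le> T"
  shows "solution_map z X t - solution_map z X s
    = integral {s..t} (\<lambda>\<tau>. b \<tau> (X \<tau>)) + stieltjes (\<lambda>\<tau>. \<sigma> \<tau> (X \<tau>)) g s t"
proof -
  obtain K where K: "K \<ge> 0" "holder_bound \<beta> K {0..T} (\<lambda>t. \<sigma> t (X t))"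
    using X by (rule diffusion_holder)
  have "integral {0..s} (\<lambda>\<tau>. b \<tau> (X \<tau>)) + integral {s..t} (\<lambda>\<tau>. b \<tau> (X \<tau>))
      = integral {0..t} (\<lambda>\<tau>. b \<tau> (X \<tau>))"
    using st X by (intro Henstock_Kurzweil_Integration.integral_combine drift_integrable) auto
  moreover have "stieltjes (\<lambda>\<tau>. \<sigma> \<tau> (X \<tau>)) g 0 s + stieltjes (\<lambda>\<tau>. \<sigma> \<tau> (X \<tau>)) g s t
      = stieltjes (\<lambda>\<tau>. \<sigma> \<tau> (X \<tau>)) g 0 t"
    by (rule stieltjes_combine[OF K(2) g]) (use st \<beta> \<gamma> \<beta>\<gamma> K G in auto)
  ultimately show ?thesis by (simp add: solution_map_def)
qed

text \<open>
  In \<open>\<bar>F s\<bar> G (t-s)\<^bsup>\<gamma>\<^esup> + O((t-s)\<^bsup>\<beta>+\<gamma>\<^esup>)\<close> both terms carry the exponent \<open>\<gamma>\<close> at least, so that the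
  indefinite integral is as regular as the driver, whatever the regularity of the integrand.
\<close>

lemma stieltjes_bound:
  assumes F: "holder_bound \<beta> K {a..c} F" and "0 \<le> a" "c \<le> T" "K \<ge> 0"
    and sup: "\<bar>F s\<bar> \<le> B" and st: "a \<le> s" "s \<le> t" "t \<le> c"
  shows "\<bar>stieltjes F g s t\<bar> \<le> (B * G + sewing_const (\<beta> + \<gamma>) * K * G * W) * (t - s) powr \<gamma>"
proof -
  let ?C = "sewing_const (\<beta> + \<gamma>)"
  have C: "?C \<ge> 0" using \<beta>\<gamma> by (rule sewing_const_nonneg)
  have gac: "holder_bound \<gamma> G {a..c} g" using g by (rule holder_bound_subset) (use assms in auto)
  have "\<bar>stieltjes F g s t - F s * (g t - g s)\<bar> \<le> ?C * K * G * (t - s) powr (\<beta> + \<gamma>)"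
    by (rule stieltjes_estimate[OF F gac]) (use assms \<beta> \<beta>\<gamma> G in auto)
  also have "\<dots> \<le> ?C * K * G * (W * (t - s) powr \<gamma>)"
    using assms C G \<beta> \<gamma> by (intro mult_left_mono powr_le_W_powr) auto
  finally have 1: "\<bar>stieltjes F g s t - F s * (g t - g s)\<bar> \<le> ?C * K * G * W * (t - s) powr \<gamma>"
    by (simp add: mult.assoc)
  have "\<bar>g t - g s\<bar> \<le> G * \<bar>t - s\<bar> powr \<gamma>" using gac st by (intro holder_boundD) auto
  then have "\<bar>F s\<bar> * \<bar>g t - g s\<bar> \<le> B * (G * (t - s) powr \<gamma>)"
    using sup st by (intro mult_mono) auto
  then have "\<bar>F s * (g t - g s)\<bar> \<le> B * G * (t - s) powr \<gamma>" by (simp add: abs_mult mult.assoc)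
  with 1 show ?thesis unfolding distrib_right by linarith
qed

text \<open>
  The source of smallness: \<open>(t-s)\<^bsup>\<gamma>\<^esup> \<le> h\<^bsup>\<gamma>-\<beta>\<^esup> (t-s)\<^bsup>\<beta>\<^esup>\<close> on an interval of length at most \<open>h\<close>.
\<close>

lemma holder_bound_of_better_exponent:
  assumes inc: "\<And>s t. a \<le> s \<Longrightarrow> s < t \<Longrightarrow> t \<le> c \<Longrightarrow> \<bar>f t - f s\<bar> \<le> C * (t - s) powr \<gamma>"
    and "C \<ge> 0" "c - a \<le> h"
  shows "holder_bound \<beta> (C * h powr (\<gamma> - \<beta>)) {a..c} f"
proof (rule holder_boundI_ordered)
  fix s t assume st: "s \<in> {a..c}" "t \<in> {a..c}" "s < t"
  have "\<bar>f t - f s\<bar> \<le> C * (t - s) powr \<gamma>" using st by (intro inc) auto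
  also have "(t - s) powr \<gamma> = (t - s) powr (\<gamma> - \<beta>) * (t - s) powr \<beta>"
    using powr_add[of "t - s" "\<gamma> - \<beta>" \<beta>] by simp
  also have "C * \<dots> \<le> C * (h powr (\<gamma> - \<beta>) * (t - s) powr \<beta>)"
    using st assms \<beta> by (intro mult_left_mono mult_right_mono powr_mono2) auto
  finally show "\<bar>f t - f s\<bar> \<le> C * h powr (\<gamma> - \<beta>) * (t - s) powr \<beta>" by (simp add: mult.assoc)
qed

text \<open>
  \<open>A0\<close> is the constant of linear growth of both coefficients. In \<open>A\<close> the first summand is the
  constant of the growth estimate and the second that of the contraction estimate; each is
  assembled from the drift, the one-point approximation and the Young remainder.
\<close>

definition A0 :: real where "A0 = \<bar>b 0 0\<bar> + \<bar>\<sigma> 0 0\<bar> + L * (T + W)"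

definition A :: real where
  "A = (A0 * W + A0 * G + sewing_const (\<beta> + \<gamma>) * (L * W) * G * W)
     + (L * W * W + L * W * G + sewing_const (\<beta> + \<gamma>) * (2 * L * W * W) * G * W)"

lemma A0: "A0 \<ge> 0" using L T W by (simp add: A0_def)

lemma A: "A \<ge> 0"
  using A0 L W G \<beta>\<gamma> by (auto simp: A_def intro!: add_nonneg_nonneg mult_nonneg_nonneg sewing_const_nonneg)

lemma linear_growth:
  assumes lip: "\<And>s t x y. s \<ge> 0 \<Longrightarrow> t \<ge> 0 \<Longrightarrow> \<bar>f t x - f s y\<bar> \<le> L * (\<bar>t - s\<bar> + \<bar>x - y\<bar>)"
    and f0: "\<bar>f 0 0\<bar> \<le> \<bar>b 0 0\<bar> + \<bar>\<sigma> 0 0\<bar>"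
    and X: "holder_bound \<beta> K {a..c} X" and ac: "0 \<le> a" "c \<le> T" "r \<in> {a..c}" "K \<ge> 0"
  shows "\<bar>f r (X r)\<bar> \<le> A0 * (1 + \<bar>X a\<bar> + K)"
proof -
  let ?N = "1 + \<bar>X a\<bar> + K"
  have N: "?N \<ge> 1" using ac by simp
  have "\<bar>X r\<bar> \<le> \<bar>X a\<bar> + K * W" using holder_bound_from_start[OF X ac] by linarith
  also have "\<dots> \<le> \<bar>X a\<bar> * W + K * W" using W by (simp add: mult_le_cancel_left1)
  finally have Xr: "\<bar>X r\<bar> \<le> W * (\<bar>X a\<bar> + K)" by (simp add: algebra_simps)
  have "\<bar>f r (X r)\<bar> \<le> \<bar>f 0 0\<bar> + L * (\<bar>r\<bar> + \<bar>X r\<bar>)" using lip[of 0 r "X r" 0] ac by simp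
  also have "\<dots> \<le> \<bar>f 0 0\<bar> + L * (T + W * (\<bar>X a\<bar> + K))"
    using L Xr ac by (intro add_left_mono mult_left_mono add_mono) auto
  also have "\<dots> \<le> (\<bar>b 0 0\<bar> + \<bar>\<sigma> 0 0\<bar>) * ?N + L * ((T + W) * ?N)"
  proof (intro add_mono mult_left_mono)
    show "\<bar>f 0 0\<bar> \<le> (\<bar>b 0 0\<bar> + \<bar>\<sigma> 0 0\<bar>) * ?N"
      using f0 N mult_left_mono[OF N, of "\<bar>b 0 0\<bar> + \<bar>\<sigma> 0 0\<bar>"] by simp
    have "T * 1 \<le> T * ?N" using N T by (intro mult_left_mono) auto
    then show "T + W * (\<bar>X a\<bar> + K) \<le> (T + W) * ?N" using W by (simp add: algebra_simps)
  qed (rule L)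
  finally show ?thesis by (simp add: A0_def algebra_simps)
qed

text \<open>
  The bound is affine in the Hoelder constant \<open>K\<close> and in \<open>\<bar>X a\<bar>\<close>, with coefficients that depend on
  the data only. This is why solutions cannot explode.
\<close>

lemma solution_map_growth:
  assumes hX: "holder_path X" and X: "holder_bound \<beta> K {a..c} X"
    and ac: "0 \<le> a" "c \<le> T" "c - a \<le> h" "K \<ge> 0"
  shows "holder_bound \<beta> (A * h powr (\<gamma> - \<beta>) * (1 + \<bar>X a\<bar> + K)) {a..c} (solution_map z X)"
proof -
  let ?N = "1 + \<bar>X a\<bar> + K"
  let ?C = "sewing_const (\<beta> + \<gamma>)"
  have C: "?C \<ge> 0" using \<beta>\<gamma> by (rule sewing_const_nonneg)
  have N: "?N \<ge> 1" using ac by simp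
  have inc: "\<bar>solution_map z X t - solution_map z X s\<bar> \<le> (A * ?N) * (t - s) powr \<gamma>"
    if st: "a \<le> s" "s < t" "t \<le> c" for s t
  proof -
    have "\<bar>integral {s..t} (\<lambda>\<tau>. b \<tau> (X \<tau>))\<bar> \<le> A0 * ?N * (t - s)"
    proof -
      have "norm (integral {s..t} (\<lambda>\<tau>. b \<tau> (X \<tau>))) \<le> A0 * ?N * (t - s)"
        using st ac
        by (intro integral_bound continuous_on_subset[OF drift_continuous[OF hX]])
          (auto intro!: linear_growth[where f = b, OF b_lipschitz _ X])
      then show ?thesis by simp
    qed
    also have "\<dots> \<le> A0 * ?N * (W * (t - s) powr \<gamma>)"
      using st ac A0 N \<beta> \<gamma> by (intro mult_left_mono self_le_W_powr) auto
    finally have 1: "\<bar>integral {s..t} (\<lambda>\<tau>. b \<tau> (X \<tau>))\<bar> \<le> (A0 * W) * ?N * (t - s) powr \<gamma>"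
      by (simp add: mult_ac)
    have "holder_bound \<beta> (L * W * ?N) {a..c} (\<lambda>t. \<sigma> t (X t))"
    proof (rule holder_bound_mono)
      show "holder_bound \<beta> (L * (W + K)) {a..c} (\<lambda>t. \<sigma> t (X t))"
        by (rule holder_bound_compose[OF \<sigma>_lipschitz X ac(1,2)])
      have "0 \<le> W * \<bar>X a\<bar>" "K * 1 \<le> K * W"
        using W ac mult_left_mono[of 1 W K] by auto
      then have "W + K \<le> W * ?N" by (simp add: algebra_simps)
      then show "L * (W + K) \<le> L * W * ?N" using L by (simp add: mult.assoc mult_left_mono)
    qed
    moreover have "\<bar>\<sigma> s (X s)\<bar> \<le> A0 * ?N"
      using st ac by (intro linear_growth[where f = \<sigma>, OF \<sigma>_lipschitz _ X]) auto
    ultimately have 2: "\<bar>stieltjes (\<lambda>\<tau>. \<sigma> \<tau> (X \<tau>)) g s t\<bar>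
        \<le> (A0 * ?N * G + ?C * (L * W * ?N) * G * W) * (t - s) powr \<gamma>"
      using st ac N W L by (intro stieltjes_bound[where a = a and c = c]) auto
    have "\<bar>solution_map z X t - solution_map z X s\<bar>
        \<le> (A0 * W) * ?N * (t - s) powr \<gamma> + (A0 * ?N * G + ?C * (L * W * ?N) * G * W) * (t - s) powr \<gamma>"
      using solution_map_increment[OF hX, of s t z] 1 2 st ac by simp
    also have "\<dots> = (A0 * W + A0 * G + ?C * (L * W) * G * W) * (?N * (t - s) powr \<gamma>)"
      by (simp add: algebra_simps)
    also have "\<dots> \<le> A * (?N * (t - s) powr \<gamma>)"
      using N L W G C by (intro mult_right_mono) (auto simp: A_def)
    finally show ?thesis by (simp add: mult.assoc)
  qed
  have "holder_bound \<beta> ((A * ?N) * h powr (\<gamma> - \<beta>)) {a..c} (solution_map z X)"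
    using inc A N ac by (intro holder_bound_of_better_exponent) auto
  then show ?thesis by (simp add: mult_ac)
qed

text \<open>
  The Hoelder constant of \<open>\<sigma>(t, X(t)) - \<sigma>(t, Y(t))\<close> comes from the second-difference bound and
  contains the product of \<open>\<bar>X - Y\<bar>\<close> with the Hoelder constants of \<open>X\<close> and \<open>Y\<close>; hence the factor
  \<open>1 + K\<close>, which excludes a step length valid for all paths at once.
\<close>

lemma solution_map_contraction:
  assumes hX: "holder_path X" and X: "holder_bound \<beta> K {a..c} X"
    and hY: "holder_path Y" and Y: "holder_bound \<beta> K {a..c} Y"
    and D: "holder_bound \<beta> d {a..c} (\<lambda>t. X t - Y t)" and start: "X a = Y a"
    and ac: "0 \<le> a" "c \<le> T" "c - a \<le> h" "K \<ge> 0" "d \<ge> 0"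
  shows "holder_bound \<beta> (A * h powr (\<gamma> - \<beta>) * (1 + K) * d) {a..c}
    (\<lambda>t. solution_map z X t - solution_map z Y t)"
proof -
  let ?C = "sewing_const (\<beta> + \<gamma>)"
  let ?F = "\<lambda>t. \<sigma> t (X t) - \<sigma> t (Y t)"
  have C: "?C \<ge> 0" using \<beta>\<gamma> by (rule sewing_const_nonneg)
  have Dsup: "\<bar>X r - Y r\<bar> \<le> d * W" if "r \<in> {a..c}" for r
    using holder_bound_from_start[OF D ac(1,2) that ac(5)] start by simp
  have F: "holder_bound \<beta> (2 * L * W * W * (1 + K) * d) {a..c} ?F"
    unfolding holder_bound_def
  proof (intro ballI)
    fix s t assume st: "s \<in> {a..c}" "t \<in> {a..c}"
    let ?p = "\<bar>s - t\<bar> powr \<beta>"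
    have "\<bar>?F s - ?F t\<bar> \<le> L * (\<bar>(X s - Y s) - (X t - Y t)\<bar> +
        \<bar>X t - Y t\<bar> * (\<bar>s - t\<bar> + \<bar>X s - X t\<bar> + \<bar>Y s - Y t\<bar>))"
      using st ac by (intro \<sigma>_second_difference) auto
    also have "\<dots> \<le> L * (d * ?p + (d * W) * (W * ?p + K * ?p + K * ?p))"
      using st ac \<beta> \<gamma> L W holder_boundD[OF D st]
      by (intro mult_left_mono add_mono mult_mono Dsup self_le_W_powr
          holder_boundD[OF X] holder_boundD[OF Y]) auto
    also have "\<dots> = L * d * ?p * (1 + W * W + 2 * (W * K))" by (simp add: algebra_simps)
    also have "\<dots> \<le> L * d * ?p * (2 * (W * W) * (1 + K))"
    proof (intro mult_left_mono)
      have "1 \<le> W * W" using W mult_mono[of 1 W 1 W] by simp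
      moreover have "W * K \<le> W * W * K" using W ac by (intro mult_right_mono) auto
      ultimately show "1 + W * W + 2 * (W * K) \<le> 2 * (W * W) * (1 + K)"
        by (simp add: algebra_simps)
    qed (use L ac in auto)
    finally show "\<bar>?F s - ?F t\<bar> \<le> 2 * L * W * W * (1 + K) * d * ?p" by (simp add: mult_ac)
  qed
  obtain K1 where K1: "K1 \<ge> 0" "holder_bound \<beta> K1 {0..T} (\<lambda>t. \<sigma> t (X t))"
    using hX by (rule diffusion_holder)
  obtain K2 where K2: "K2 \<ge> 0" "holder_bound \<beta> K2 {0..T} (\<lambda>t. \<sigma> t (Y t))"
    using hY by (rule diffusion_holder)
  have inc: "\<bar>(solution_map z X t - solution_map z Y t) - (solution_map z X s - solution_map z Y s)\<bar>
      \<le> (A * (1 + K) * d) * (t - s) powr \<gamma>"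
    if st: "a \<le> s" "s < t" "t \<le> c" for s t
  proof -
    have int: "(\<lambda>\<tau>. b \<tau> (X \<tau>)) integrable_on {s..t}" "(\<lambda>\<tau>. b \<tau> (Y \<tau>)) integrable_on {s..t}"
      using st ac by (auto intro!: drift_integrable hX hY)
    have "norm (integral {s..t} (\<lambda>\<tau>. b \<tau> (X \<tau>) - b \<tau> (Y \<tau>))) \<le> (L * (d * W)) * (t - s)"
    proof (rule integral_bound)
      show "continuous_on {s..t} (\<lambda>\<tau>. b \<tau> (X \<tau>) - b \<tau> (Y \<tau>))"
        using st ac by (intro continuous_on_diff continuous_on_subset[OF drift_continuous] hX hY) auto
      fix r assume r: "r \<in> {s..t}"
      have "\<bar>b r (X r) - b r (Y r)\<bar> \<le> L * \<bar>X r - Y r\<bar>"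
        using b_lipschitz[of r r "X r" "Y r"] r st ac by simp
      also have "\<dots> \<le> L * (d * W)" using r st L by (intro mult_left_mono Dsup) auto
      finally show "norm (b r (X r) - b r (Y r)) \<le> L * (d * W)" by simp
    qed (use st in auto)
    also have "\<dots> \<le> (L * (d * W)) * (W * (t - s) powr \<gamma>)"
      using st ac L W \<beta> \<gamma> by (intro mult_left_mono self_le_W_powr) auto
    finally have 1: "\<bar>integral {s..t} (\<lambda>\<tau>. b \<tau> (X \<tau>)) - integral {s..t} (\<lambda>\<tau>. b \<tau> (Y \<tau>))\<bar>
        \<le> (L * W * W) * d * (t - s) powr \<gamma>"
      using int by (simp add: integral_diff mult_ac)
    have "has_stieltjes_integral (\<lambda>t. \<sigma> t (X t)) g s t (stieltjes (\<lambda>t. \<sigma> t (X t)) g s t)"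
      by (rule has_stieltjes_integral_stieltjes[OF K1(2) g]) (use st ac \<beta> \<beta>\<gamma> G K1 in auto)
    moreover have "has_stieltjes_integral (\<lambda>t. \<sigma> t (Y t)) g s t (stieltjes (\<lambda>t. \<sigma> t (Y t)) g s t)"
      by (rule has_stieltjes_integral_stieltjes[OF K2(2) g]) (use st ac \<beta> \<beta>\<gamma> G K2 in auto)
    ultimately have "stieltjes ?F g s t
        = stieltjes (\<lambda>t. \<sigma> t (X t)) g s t - stieltjes (\<lambda>t. \<sigma> t (Y t)) g s t"
      using st by (intro stieltjes_eq has_stieltjes_integral_diff) auto
    moreover have "\<bar>?F s\<bar> \<le> L * (d * W)"
    proof -
      have "\<bar>?F s\<bar> \<le> L * \<bar>X s - Y s\<bar>" using \<sigma>_lipschitz[of s s "X s" "Y s"] st ac by simp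
      also have "\<dots> \<le> L * (d * W)" using st L by (intro mult_left_mono Dsup) auto
      finally show ?thesis .
    qed
    then have "\<bar>stieltjes ?F g s t\<bar>
        \<le> (L * (d * W) * G + ?C * (2 * L * W * W * (1 + K) * d) * G * W) * (t - s) powr \<gamma>"
      using st ac L W by (intro stieltjes_bound[OF F]) auto
    ultimately have 2: "\<bar>stieltjes (\<lambda>t. \<sigma> t (X t)) g s t - stieltjes (\<lambda>t. \<sigma> t (Y t)) g s t\<bar>
        \<le> (L * (d * W) * G + ?C * (2 * L * W * W * (1 + K) * d) * G * W) * (t - s) powr \<gamma>"
      by simp
    have "\<bar>(solution_map z X t - solution_map z Y t) - (solution_map z X s - solution_map z Y s)\<bar>
      \<le> (L * W * W) * d * (t - s) powr \<gamma>
        + (L * (d * W) * G + ?C * (2 * L * W * W * (1 + K) * d) * G * W) * (t - s) powr \<gamma>"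
      using solution_map_increment[OF hX, of s t z] solution_map_increment[OF hY, of s t z] 1 2 st ac
      by (simp add: abs_le_iff)
    also have "\<dots> = ((L * W * W + L * W * G) * 1 + ?C * (2 * L * W * W) * G * W * (1 + K))
        * (d * (t - s) powr \<gamma>)"
      by (simp add: algebra_simps)
    also have "\<dots> \<le> ((L * W * W + L * W * G) * (1 + K) + ?C * (2 * L * W * W) * G * W * (1 + K))
        * (d * (t - s) powr \<gamma>)"
      using L W G ac by (intro mult_right_mono add_mono mult_left_mono) auto
    also have "\<dots> = (L * W * W + L * W * G + ?C * (2 * L * W * W) * G * W)
        * ((1 + K) * (d * (t - s) powr \<gamma>))"
      by (simp add: algebra_simps)
    also have "\<dots> \<le> A * ((1 + K) * (d * (t - s) powr \<gamma>))"
      using A0 L W G C ac by (intro mult_right_mono) (auto simp: A_def)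
    finally show ?thesis by (simp add: mult.assoc)
  qed
  have "holder_bound \<beta> ((A * (1 + K) * d) * h powr (\<gamma> - \<beta>)) {a..c}
      (\<lambda>t. solution_map z X t - solution_map z Y t)"
    using inc A ac by (intro holder_bound_of_better_exponent) auto
  then show ?thesis by (simp add: mult_ac)
qed

lemma small_step:
  assumes "C \<ge> 0"
  obtains h where "h > 0" "C * h powr (\<gamma> - \<beta>) \<le> 1 / 2"
proof
  define e where "e = \<gamma> - \<beta>"
  have e: "e > 0" using \<beta> by (simp add: e_def)
  let ?h = "(1 / (2 * (C + 1))) powr (1 / e)"
  show "?h > 0" using assms by simp
  have "?h powr e = 1 / (2 * (C + 1))" using e assms by (simp add: powr_powr)
  then have "C * ?h powr (\<gamma> - \<beta>) = C / (2 * (C + 1))" by (simp add: e_def)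
  also have "\<dots> \<le> 1 / 2" using assms by (simp add: divide_simps)
  finally show "C * ?h powr (\<gamma> - \<beta>) \<le> 1 / 2" .
qed

text \<open>
  If \<open>A h\<^bsup>\<gamma>-\<beta>\<^esup> \<le> 1/2\<close>, the growth estimate replaces a Hoelder constant \<open>K\<close> of a fixed point by the
  average of \<open>K\<close> and \<open>1 + \<bar>X a\<bar>\<close>.
\<close>

lemma fixed_point_local_bound:
  assumes hX: "holder_path X" and fixp: "\<And>t. t \<in> {a..c} \<Longrightarrow> X t = solution_map z X t"
    and ac: "0 \<le> a" "c \<le> T" "c - a \<le> h" and h: "A * h powr (\<gamma> - \<beta>) \<le> 1 / 2"
  shows "holder_bound \<beta> (1 + \<bar>X a\<bar>) {a..c} X"
proof -
  from hX obtain K0 where K0: "K0 \<ge> 0" "holder_bound \<beta> K0 {0..T} X" by (rule holder_pathE)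
  have "holder_bound \<beta> K0 {a..c} X" using K0(2) by (rule holder_bound_subset) (use ac in auto)
  then show ?thesis
  proof (rule holder_bound_halving)
    fix K :: real assume K: "K \<ge> 0" "holder_bound \<beta> K {a..c} X"
    have "A * h powr (\<gamma> - \<beta>) * (1 + \<bar>X a\<bar> + K) \<le> 1 / 2 * (1 + \<bar>X a\<bar> + K)"
      using h K by (intro mult_right_mono) auto
    then have "holder_bound \<beta> ((1 + \<bar>X a\<bar> + K) / 2) {a..c} (solution_map z X)"
      using holder_bound_mono[OF solution_map_growth[OF hX K(2) ac K(1)]] by simp
    then show "holder_bound \<beta> ((1 + \<bar>X a\<bar> + K) / 2) {a..c} X"
      using holder_bound_cong[of "{a..c}" X "solution_map z X"] fixp by blast
  qed (use K0 in auto)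
qed

text \<open>
  One step of length \<open>h\<close> raises a bound \<open>R\<close> to at most \<open>R + (1 + R) W\<close>, and \<open>h\<close> does not depend on
  the solution; finitely many steps cover \<open>[0,T]\<close>. The bound is stated for solutions on any initial
  interval \<open>[0,c]\<close>, as it has to control partial solutions during the construction.
\<close>

lemma a_priori_bound:
  obtains R where "R \<ge> 0"
    "\<And>X c t. holder_path X \<Longrightarrow> c \<le> T \<Longrightarrow> (\<And>t. t \<in> {0..c} \<Longrightarrow> X t = solution_map z X t) \<Longrightarrow>
      t \<in> {0..c} \<Longrightarrow> \<bar>X t\<bar> \<le> R"
proof -
  obtain h where h: "h > 0" "A * h powr (\<gamma> - \<beta>) \<le> 1 / 2" using small_step[OF A] .
  have steps: "\<exists>R\<ge>0. \<forall>X c. holder_path X \<longrightarrow> c \<le> T \<longrightarrow> (\<forall>t\<in>{0..c}. X t = solution_map z X t) \<longrightarrow>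
      (\<forall>t\<in>{0..c}. t \<le> real k * h \<longrightarrow> \<bar>X t\<bar> \<le> R)" for k
  proof (induction k)
    case 0
    have "\<bar>X t\<bar> \<le> \<bar>z\<bar>" if "\<forall>t\<in>{0..c}. X t = solution_map z X t" "t \<in> {0..c}" "t \<le> real 0 * h" for X c t
    proof -
      have "t = 0" using that by simp
      then show ?thesis using that solution_map_0[of z X] by simp
    qed
    then show ?case by (intro exI[of _ "\<bar>z\<bar>"]) auto
  next
    case (Suc k)
    then obtain R where R: "R \<ge> 0" "\<And>X c t. holder_path X \<Longrightarrow> c \<le> T \<Longrightarrow>
        (\<forall>t\<in>{0..c}. X t = solution_map z X t) \<Longrightarrow> t \<in> {0..c} \<Longrightarrow> t \<le> real k * h \<Longrightarrow> \<bar>X t\<bar> \<le> R"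
      by blast
    have "\<bar>X t\<bar> \<le> R + (1 + R) * W"
      if hX: "holder_path X" and c: "c \<le> T" and fixp: "\<forall>t\<in>{0..c}. X t = solution_map z X t"
        and t: "t \<in> {0..c}" "t \<le> real (Suc k) * h" for X c t
    proof -
      let ?a = "min t (real k * h)"
      have a: "?a \<ge> 0" "?a \<le> t" "t - ?a \<le> h" using t h by (auto simp: algebra_simps)
      have Xa: "\<bar>X ?a\<bar> \<le> R" using t a by (intro R(2)[OF hX c fixp]) auto
      have "holder_bound \<beta> (1 + \<bar>X ?a\<bar>) {?a..t} X"
      proof (rule fixed_point_local_bound[OF hX _ a(1) _ a(3) h(2)])
        fix r assume "r \<in> {?a..t}"
        then have "r \<in> {0..c}" using order_trans[OF a(1)] t by auto
        then show "X r = solution_map z X r" using fixp by blast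
      qed (use t c in simp)
      from holder_bound_from_start[OF this, of t]
      have "\<bar>X t - X ?a\<bar> \<le> (1 + \<bar>X ?a\<bar>) * W" using a t c by simp
      also have "\<dots> \<le> (1 + R) * W" using Xa W by (intro mult_right_mono) auto
      finally show ?thesis using Xa by linarith
    qed
    moreover have "R + (1 + R) * W \<ge> 0" using R(1) W by simp
    ultimately show ?case by (intro exI[of _ "R + (1 + R) * W"]) blast
  qed
  obtain k where "T / h < real k" using reals_Archimedean2 by blast
  then have k: "T \<le> real k * h" using h(1) by (simp add: field_simps)
  obtain R where R: "R \<ge> 0" "\<forall>X c. holder_path X \<longrightarrow> c \<le> T \<longrightarrow>
      (\<forall>t\<in>{0..c}. X t = solution_map z X t) \<longrightarrow> (\<forall>t\<in>{0..c}. t \<le> real k * h \<longrightarrow> \<bar>X t\<bar> \<le> R)"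
    using steps[of k] by blast
  show ?thesis
  proof (rule that[OF R(1)])
    fix X c t
    assume "holder_path X" "c \<le> T" "\<And>t. t \<in> {0..c} \<Longrightarrow> X t = solution_map z X t" "t \<in> {0..c}"
    moreover from this have "t \<le> real k * h" using k by auto
    ultimately show "\<bar>X t\<bar> \<le> R" using R(2) by blast
  qed
qed

text \<open>
  If two solutions agree up to time \<open>a\<close>, the contraction estimate on the next interval, with the
  Hoelder constant \<open>1 + R\<close> supplied by the a priori bound, halves the Hoelder constant of their
  difference indefinitely.
\<close>

lemma fixed_point_unique:
  assumes hX: "holder_path X" and X: "\<And>t. t \<in> {0..T} \<Longrightarrow> X t = solution_map z X t"
    and hY: "holder_path Y" and Y: "\<And>t. t \<in> {0..T} \<Longrightarrow> Y t = solution_map z Y t"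
    and t: "t \<in> {0..T}"
  shows "X t = Y t"
proof -
  obtain R where R: "R \<ge> 0" "\<And>X c t. holder_path X \<Longrightarrow> c \<le> T \<Longrightarrow>
      (\<And>t. t \<in> {0..c} \<Longrightarrow> X t = solution_map z X t) \<Longrightarrow> t \<in> {0..c} \<Longrightarrow> \<bar>X t\<bar> \<le> R"
    using a_priori_bound[of z] by metis
  have "A * (2 + R) \<ge> 0" using A R by simp
  then obtain h where h: "h > 0" "A * (2 + R) * h powr (\<gamma> - \<beta>) \<le> 1 / 2" by (rule small_step)
  have "A * h powr (\<gamma> - \<beta>) * 1 \<le> A * h powr (\<gamma> - \<beta>) * (2 + R)"
    using A R by (intro mult_left_mono) auto
  with h(2) have h1: "A * h powr (\<gamma> - \<beta>) \<le> 1 / 2" by (simp add: algebra_simps)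
  have agree: "\<forall>t\<in>{0..T}. t \<le> real k * h \<longrightarrow> X t = Y t" for k
  proof (induction k)
    case 0
    then show ?case using X[of 0] Y[of 0] T by (auto simp: solution_map_0)
  next
    case (Suc k)
    show ?case
    proof (intro ballI impI)
      fix t assume t: "t \<in> {0..T}" "t \<le> real (Suc k) * h"
      let ?a = "min t (real k * h)"
      have a: "?a \<ge> 0" "?a \<le> t" "t - ?a \<le> h" using t h by (auto simp: algebra_simps)
      have tT: "t \<le> T" using t by simp
      have start: "X ?a = Y ?a" using Suc a t by auto
      have bound: "holder_bound \<beta> (1 + R) {?a..t} V"
        if hV: "holder_path V" and V: "\<And>t. t \<in> {0..T} \<Longrightarrow> V t = solution_map z V t" for V
      proof (rule holder_bound_mono)
        show "holder_bound \<beta> (1 + \<bar>V ?a\<bar>) {?a..t} V"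
        proof (rule fixed_point_local_bound[OF hV _ a(1) tT a(3) h1])
          fix r assume "r \<in> {?a..t}"
          then have "r \<in> {0..T}" using order_trans[OF a(1)] tT by auto
          then show "V r = solution_map z V r" by (rule V)
        qed
        show "1 + \<bar>V ?a\<bar> \<le> 1 + R" using R(2)[OF hV order_refl V, of ?a] a t by auto
      qed
      have "holder_bound \<beta> ((1 + R) + (1 + R)) {?a..t} (\<lambda>t. X t - Y t)"
        by (intro holder_bound_diff bound hX hY X Y)
      then have "holder_bound \<beta> 0 {?a..t} (\<lambda>t. X t - Y t)"
      proof (rule holder_bound_halving)
        fix d :: real assume d: "d \<ge> 0" "holder_bound \<beta> d {?a..t} (\<lambda>t. X t - Y t)"
        have "(A * (2 + R) * h powr (\<gamma> - \<beta>)) * d \<le> 1 / 2 * d"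
          using h d by (intro mult_right_mono) auto
        then have "A * h powr (\<gamma> - \<beta>) * (1 + (1 + R)) * d \<le> (0 + d) / 2" by (simp add: algebra_simps)
        moreover have "holder_bound \<beta> (A * h powr (\<gamma> - \<beta>) * (1 + (1 + R)) * d) {?a..t}
            (\<lambda>t. solution_map z X t - solution_map z Y t)"
          using R(1) by (intro solution_map_contraction[OF hX bound[OF hX X] hY bound[OF hY Y]
                d(2) start a(1) tT a(3) _ d(1)]) auto
        ultimately have *: "holder_bound \<beta> ((0 + d) / 2) {?a..t}
            (\<lambda>t. solution_map z X t - solution_map z Y t)"
          by (rule holder_bound_mono[rotated])
        have "X r - Y r = solution_map z X r - solution_map z Y r" if "r \<in> {?a..t}" for r
          using X[of r] Y[of r] order_trans[OF a(1), of r] that tT by auto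
        with * show "holder_bound \<beta> ((0 + d) / 2) {?a..t} (\<lambda>t. X t - Y t)"
          using holder_bound_cong[of "{?a..t}" "\<lambda>t. X t - Y t"
              "\<lambda>t. solution_map z X t - solution_map z Y t"] by blast
      qed (use R in auto)
      from holder_boundD[OF this, of t ?a] start a show "X t = Y t" by simp
    qed
  qed
  obtain k where "T / h < real k" using reals_Archimedean2 by blast
  then have "T \<le> real k * h" using h(1) by (simp add: field_simps)
  then show ?thesis using agree[of k] t by auto
qed

lemma holder_path_stopped:
  assumes "holder_path X" "c \<ge> 0"
  shows "holder_path (\<lambda>t. X (min t c))"
proof -
  from assms obtain K where K: "K \<ge> 0" "holder_bound \<beta> K {0..T} X" by (elim holder_pathE)
  have "holder_bound \<beta> K {0..T} (\<lambda>t. X (min t c))"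
    unfolding holder_bound_def
  proof (intro ballI)
    fix x y assume xy: "x \<in> {0..T}" "y \<in> {0..T}"
    have "\<bar>X (min x c) - X (min y c)\<bar> \<le> K * \<bar>min x c - min y c\<bar> powr \<beta>"
      using xy assms(2) by (intro holder_boundD[OF K(2)]) auto
    also have "\<dots> \<le> K * \<bar>x - y\<bar> powr \<beta>"
      using K \<beta> by (intro mult_left_mono powr_mono2) auto
    finally show "\<bar>X (min x c) - X (min y c)\<bar> \<le> K * \<bar>x - y\<bar> powr \<beta>" .
  qed
  then show ?thesis by (auto simp: holder_path_def)
qed

lemma holder_path_solution_map:
  assumes "holder_path X"
  shows "holder_path (solution_map z X)"
proof -
  from assms obtain K where K: "K \<ge> 0" "holder_bound \<beta> K {0..T} X" by (rule holder_pathE)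
  from solution_map_growth[OF assms K(2), of T z] K(1) show ?thesis
    by (auto simp: holder_path_def)
qed

text \<open>
  Picard iteration takes place among paths on all of \<open>[0,T]\<close> that agree with \<open>X\<close> on \<open>[0,a]\<close> and are
  constant after \<open>c\<close>: \<open>Y (Suc n)\<close> is the image of \<open>Y n\<close> under the solution map, stopped at time
  \<open>c\<close>. By causality the iterates keep the values of \<open>X\<close> on \<open>[0,a]\<close>, so that all estimates concern
  \<open>[a,c]\<close> only.
\<close>

lemma extend_fixed_point:
  assumes hX: "holder_path X" and X: "\<And>t. t \<in> {0..a} \<Longrightarrow> X t = solution_map z X t"
    and ac: "0 \<le> a" "a \<le> c" "c \<le> T" "c - a \<le> h"
    and R: "\<bar>X a\<bar> \<le> R" and h: "A * (2 + R) * h powr (\<gamma> - \<beta>) \<le> 1 / 2"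
  obtains Z where "holder_path Z" "\<And>t. t \<in> {0..c} \<Longrightarrow> Z t = solution_map z Z t"
proof -
  have R0: "R \<ge> 0" using R by linarith
  have "A * h powr (\<gamma> - \<beta>) * 1 \<le> A * h powr (\<gamma> - \<beta>) * (2 + R)"
    using A R0 by (intro mult_left_mono) auto
  with h have h1: "A * h powr (\<gamma> - \<beta>) \<le> 1 / 2" by (simp add: algebra_simps)
  define Y where "Y = rec_nat (\<lambda>t. X (min t a)) (\<lambda>_ Z t. solution_map z Z (min t c))"
  have Y0: "Y 0 = (\<lambda>t. X (min t a))" by (simp add: Y_def)
  have YS: "Y (Suc n) = (\<lambda>t. solution_map z (Y n) (min t c))" for n by (simp add: Y_def)
  have hY: "holder_path (Y n)" for n
    by (induction n) (use ac in \<open>auto simp: Y0 YS intro!: holder_path_stopped holder_path_solution_map hX\<close>)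
  have YX: "Y n t = X t" if "t \<in> {0..a}" for n t
  proof (cases n)
    case 0 then show ?thesis using that by (simp add: Y0)
  next
    case (Suc m)
    have "Y m s = X s" if "s \<in> {0..a}" for s m
      using that
    proof (induction m arbitrary: s)
      case (Suc m)
      have "solution_map z (Y m) s = solution_map z X s" using Suc by (intro solution_map_cong) auto
      then show ?case using X Suc.prems ac by (simp add: YS)
    qed (simp add: Y0)
    then show ?thesis using that by simp
  qed
  have Ya: "Y n a = X a" for n using YX[of a n] ac by simp
  have Ystop: "Y n t = Y n (min t c)" for n t
    by (cases n) (use ac in \<open>auto simp: Y0 YS min_def\<close>)
  have YK: "holder_bound \<beta> (1 + R) {a..c} (Y n)" for n
  proof (induction n)
    case 0
    have "holder_bound \<beta> (1 + R) {a..c} (\<lambda>t. X a)" using R0 by (simp add: holder_bound_def)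
    moreover have "Y 0 t = X a" if "t \<in> {a..c}" for t using that by (simp add: Y0 min_absorb2)
    ultimately show ?case using holder_bound_cong[of "{a..c}" "Y 0" "\<lambda>t. X a"] by blast
  next
    case (Suc n)
    have "A * h powr (\<gamma> - \<beta>) * (1 + \<bar>Y n a\<bar> + (1 + R)) \<le> 1 / 2 * (2 * (1 + R))"
      using h1 R R0 A by (intro mult_mono) (auto simp: Ya)
    then have "holder_bound \<beta> (1 + R) {a..c} (solution_map z (Y n))"
      using holder_bound_mono[OF solution_map_growth[OF hY Suc ac(1,3,4)]] R0 by simp
    then show ?case
      using holder_bound_cong[of "{a..c}" "Y (Suc n)" "solution_map z (Y n)"] by (auto simp: YS)
  qed
  have contract: "holder_bound \<beta> (d / 2) {a..c} (\<lambda>t. solution_map z V t - solution_map z (Y n) t)"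
    if "holder_path V" "holder_bound \<beta> (1 + R) {a..c} V" "V a = X a" "d \<ge> 0"
      "holder_bound \<beta> d {a..c} (\<lambda>t. V t - Y n t)" for V d n
  proof (rule holder_bound_mono)
    show "holder_bound \<beta> (A * h powr (\<gamma> - \<beta>) * (1 + (1 + R)) * d) {a..c}
        (\<lambda>t. solution_map z V t - solution_map z (Y n) t)"
      using that ac R0 by (intro solution_map_contraction hY YK) (auto simp: Ya)
    show "A * h powr (\<gamma> - \<beta>) * (1 + (1 + R)) * d \<le> d / 2"
      using mult_right_mono[OF h that(4)] by (simp add: algebra_simps)
  qed
  define d where "d = 2 * (1 + R)"
  have d0: "d \<ge> 0" using R0 by (simp add: d_def)
  have YD: "holder_bound \<beta> (d * (1/2) ^ n) {a..c} (\<lambda>t. Y (Suc n) t - Y n t)" for n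
  proof (induction n)
    case 0
    show ?case using holder_bound_diff[OF YK[of 1] YK[of 0]] by (simp add: d_def)
  next
    case (Suc n)
    have "holder_bound \<beta> (d * (1/2) ^ n / 2) {a..c}
        (\<lambda>t. solution_map z (Y (Suc n)) t - solution_map z (Y n) t)"
      using d0 by (intro contract hY YK Suc) (auto simp: Ya)
    then show ?case
      using holder_bound_cong[of "{a..c}" "\<lambda>t. Y (Suc (Suc n)) t - Y (Suc n) t"
          "\<lambda>t. solution_map z (Y (Suc n)) t - solution_map z (Y n) t"] by (auto simp: YS)
  qed
  define Z where "Z t = lim (\<lambda>n. Y n t)" for t
  have lim: "(\<lambda>n. Y n t) \<longlonglongrightarrow> Z t" if t: "t \<ge> 0" for t
  proof -
    have ptwise: "\<bar>Y (Suc n) t - Y n t\<bar> \<le> (d * W) * (1/2) ^ n" for n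
    proof (cases "t \<le> a")
      case True
      then show ?thesis using YX[of t] t d0 W by simp
    next
      case False
      then have "\<bar>(Y (Suc n) (min t c) - Y n (min t c)) - (Y (Suc n) a - Y n a)\<bar> \<le> (d * (1/2) ^ n) * W"
        using ac d0 by (intro holder_bound_from_start[OF YD]) auto
      then show ?thesis using Ystop[of _ t] by (simp add: Ya mult_ac)
    qed
    have "convergent (\<lambda>n. Y n t)"
      by (rule geometric_increments_limit[of "\<lambda>n. Y n t", OF ptwise]) (auto simp: convergent_def)
    then show ?thesis by (simp add: Z_def convergent_LIMSEQ_iff)
  qed
  have ZX: "Z t = X t" if "t \<in> {0..a}" for t
    using lim[of t] YX[OF that] that by (simp add: LIMSEQ_const_iff)
  have ZK: "holder_bound \<beta> (1 + R) {a..c} Z"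
    unfolding holder_bound_def
  proof (intro ballI)
    fix x y assume xy: "x \<in> {a..c}" "y \<in> {a..c}"
    have "(\<lambda>n. \<bar>Y n x - Y n y\<bar>) \<longlonglongrightarrow> \<bar>Z x - Z y\<bar>"
      using xy ac by (intro tendsto_intros lim) auto
    then show "\<bar>Z x - Z y\<bar> \<le> (1 + R) * \<bar>x - y\<bar> powr \<beta>"
      by (rule LIMSEQ_le_const2) (use holder_boundD[OF YK xy] in auto)
  qed
  \<comment> \<open>Summing the geometric bounds of the increments \<open>Y (Suc n) - Y n\<close>; convergence thus takes
    place in the Hoelder seminorm, as the contraction estimate demands.\<close>
  have ZD: "holder_bound \<beta> (2 * d * (1/2) ^ n) {a..c} (\<lambda>t. Z t - Y n t)" for n
    unfolding holder_bound_def
  proof (intro ballI)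
    fix x y assume xy: "x \<in> {a..c}" "y \<in> {a..c}"
    let ?y = "\<lambda>n. Y n x - Y n y"
    have "\<bar>?y (Suc n) - ?y n\<bar> \<le> (d * \<bar>x - y\<bar> powr \<beta>) * (1/2) ^ n" for n
      using holder_boundD[OF YD xy, of n] by (simp add: algebra_simps)
    then show "\<bar>(Z x - Y n x) - (Z y - Y n y)\<bar> \<le> 2 * d * (1/2) ^ n * \<bar>x - y\<bar> powr \<beta>"
    proof (rule geometric_increments_limit)
      fix l assume l: "?y \<longlonglongrightarrow> l"
        and bound: "\<And>n. \<bar>l - ?y n\<bar> \<le> d * \<bar>x - y\<bar> powr \<beta> * (1/2) ^ n / (1 - 1/2)"
      have "?y \<longlonglongrightarrow> Z x - Z y" using xy ac by (intro tendsto_intros lim) auto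
      with l have "l = Z x - Z y" by (rule LIMSEQ_unique)
      then show ?thesis using bound[of n] by (simp add: algebra_simps)
    qed auto
  qed
  have hZ: "holder_path Z"
  proof -
    from hX obtain K where K: "K \<ge> 0" "holder_bound \<beta> K {0..T} X" by (rule holder_pathE)
    have "holder_bound \<beta> K {0..a} X" using K(2) by (rule holder_bound_subset) (use ac in auto)
    then have "holder_bound \<beta> K {0..a} Z"
      using holder_bound_cong[of "{0..a}" Z X] ZX by blast
    then have 1: "holder_bound \<beta> (K + (1 + R)) {0..c} Z"
      using K(1) R0 \<beta> by (intro holder_bound_append[OF _ ZK]) auto
    have const: "Z t = Z c" if "t \<in> {c..T}" for t
    proof -
      have "min t c = c" using that by auto
      then have "(\<lambda>n. Y n t) = (\<lambda>n. Y n c)" using Ystop[of _ t] by simp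
      then show ?thesis by (simp add: Z_def)
    qed
    have "holder_bound \<beta> 0 {c..T} Z"
      unfolding holder_bound_def
    proof (intro ballI)
      fix x y assume "x \<in> {c..T}" "y \<in> {c..T}"
      then show "\<bar>Z x - Z y\<bar> \<le> 0 * \<bar>x - y\<bar> powr \<beta>" using const[of x] const[of y] by simp
    qed
    from holder_bound_append[OF 1 this] show ?thesis
      using K(1) R0 \<beta> by (auto simp: holder_path_def)
  qed
  have fixZ: "Z t = solution_map z Z t" if t: "t \<in> {0..c}" for t
  proof (cases "t \<le> a")
    case True
    have "solution_map z Z t = solution_map z X t" using True ZX by (intro solution_map_cong) auto
    then show ?thesis using X[of t] ZX[of t] True t by simp
  next
    case False
    have le: "norm (solution_map z Z t - Y (Suc n) t) \<le> (d * W) * (1/2) ^ n" for n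
    proof -
      have "holder_bound \<beta> (2 * d * (1/2) ^ n / 2) {a..c} (\<lambda>t. solution_map z Z t - solution_map z (Y n) t)"
        using d0 ac by (intro contract hZ ZK ZD) (auto simp: ZX)
      then have "\<bar>(solution_map z Z t - solution_map z (Y n) t)
          - (solution_map z Z a - solution_map z (Y n) a)\<bar> \<le> (2 * d * (1/2) ^ n / 2) * W"
        using False t ac d0 by (intro holder_bound_from_start) auto
      moreover have "solution_map z Z a = solution_map z (Y n) a"
        using ZX YX by (intro solution_map_cong) auto
      ultimately show ?thesis using t by (simp add: YS mult_ac)
    qed
    have "(\<lambda>n. (d * W) * (1/2::real) ^ n) \<longlonglongrightarrow> d * W * 0"
      by (intro tendsto_intros LIMSEQ_power_zero) simp
    then have null: "(\<lambda>n. (d * W) * (1/2::real) ^ n) \<longlonglongrightarrow> 0" by simp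
    have "(\<lambda>n. solution_map z Z t - Y (Suc n) t) \<longlonglongrightarrow> 0"
      by (rule Lim_null_comparison[OF _ null]) (intro always_eventually allI le)
    then have "(\<lambda>n. solution_map z Z t - (solution_map z Z t - Y (Suc n) t)) \<longlonglongrightarrow> solution_map z Z t - 0"
      by (intro tendsto_diff tendsto_const)
    then have "(\<lambda>n. Y (Suc n) t) \<longlonglongrightarrow> solution_map z Z t" by simp
    moreover have "(\<lambda>n. Y (Suc n) t) \<longlonglongrightarrow> Z t"
      using lim[of t, THEN LIMSEQ_Suc] t by simp
    ultimately show ?thesis using LIMSEQ_unique by blast
  qed
  from hZ fixZ show ?thesis by (rule that)
qed

lemma fixed_point_exists:
  obtains X where "holder_path X" "\<And>t. t \<in> {0..T} \<Longrightarrow> X t = solution_map z X t"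
proof -
  obtain R where R: "R \<ge> 0" "\<And>X c t. holder_path X \<Longrightarrow> c \<le> T \<Longrightarrow>
      (\<And>t. t \<in> {0..c} \<Longrightarrow> X t = solution_map z X t) \<Longrightarrow> t \<in> {0..c} \<Longrightarrow> \<bar>X t\<bar> \<le> R"
    using a_priori_bound[of z] by metis
  have "A * (2 + R) \<ge> 0" using A R by simp
  then obtain h where h: "h > 0" "A * (2 + R) * h powr (\<gamma> - \<beta>) \<le> 1 / 2" by (rule small_step)
  have steps: "\<exists>X. holder_path X \<and> (\<forall>t\<in>{0..min (real k * h) T}. X t = solution_map z X t)" for k
  proof (induction k)
    case 0
    have "holder_path (\<lambda>_. z)" by (auto simp: holder_path_def holder_bound_def intro: exI[of _ 0])
    then show ?case using T by (intro exI[of _ "\<lambda>_. z"]) (auto simp: solution_map_0)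
  next
    case (Suc k)
    let ?a = "min (real k * h) T" and ?c = "min (real (Suc k) * h) T"
    obtain X where X: "holder_path X" "\<And>t. t \<in> {0..?a} \<Longrightarrow> X t = solution_map z X t" using Suc by blast
    have ac: "0 \<le> ?a" "?a \<le> ?c" "?c \<le> T" "?c - ?a \<le> h" using h T by (auto simp: algebra_simps)
    have "\<bar>X ?a\<bar> \<le> R"
    proof (rule R(2)[OF X(1) _ X(2)])
      show "?a \<in> {0..?a}" using ac(1) by simp
    qed simp_all
    from extend_fixed_point[OF X ac this h(2)] show ?case by metis
  qed
  obtain k where "T / h < real k" using reals_Archimedean2 by blast
  then have "T \<le> real k * h" using h(1) by (simp add: field_simps)
  then have "min (real k * h) T = T" by simp
  with steps[of k] that show ?thesis by auto
qed

lemma is_solution_iff_fixed_point: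
  assumes hX: "holder_path X"
  shows "is_solution b \<sigma> z g T X \<longleftrightarrow> (\<forall>t\<in>{0..T}. X t = solution_map z X t)"
proof -
  obtain K where K: "K \<ge> 0" "holder_bound \<beta> K {0..T} (\<lambda>t. \<sigma> t (X t))"
    using hX by (rule diffusion_holder)
  have "(\<exists>I J. ((\<lambda>\<tau>. b \<tau> (X \<tau>)) has_integral I) {0..t} \<and>
      has_stieltjes_integral (\<lambda>\<tau>. \<sigma> \<tau> (X \<tau>)) g 0 t J \<and> X t = z + I + J)
      \<longleftrightarrow> X t = solution_map z X t" if t: "t \<in> {0..T}" for t
  proof
    assume "\<exists>I J. ((\<lambda>\<tau>. b \<tau> (X \<tau>)) has_integral I) {0..t} \<and>
      has_stieltjes_integral (\<lambda>\<tau>. \<sigma> \<tau> (X \<tau>)) g 0 t J \<and> X t = z + I + J"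
    then show "X t = solution_map z X t"
      using t stieltjes_eq by (auto simp: solution_map_def dest!: integral_unique)
  next
    assume "X t = solution_map z X t"
    moreover have "((\<lambda>\<tau>. b \<tau> (X \<tau>)) has_integral integral {0..t} (\<lambda>\<tau>. b \<tau> (X \<tau>))) {0..t}"
      using t hX by (intro integrable_integral drift_integrable) auto
    moreover have "has_stieltjes_integral (\<lambda>\<tau>. \<sigma> \<tau> (X \<tau>)) g 0 t (stieltjes (\<lambda>\<tau>. \<sigma> \<tau> (X \<tau>)) g 0 t)"
      by (rule has_stieltjes_integral_stieltjes[OF K(2) g]) (use t \<beta> \<beta>\<gamma> G K in auto)
    ultimately show "\<exists>I J. ((\<lambda>\<tau>. b \<tau> (X \<tau>)) has_integral I) {0..t} \<and>
      has_stieltjes_integral (\<lambda>\<tau>. \<sigma> \<tau> (X \<tau>)) g 0 t J \<and> X t = z + I + J"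
      unfolding solution_map_def by blast
  qed
  then show ?thesis by (simp add: is_solution_def)
qed

text \<open>
  Elements of the Hoelder space are extensional on \<open>[0,T]\<close>, so a fixed point has to be restricted to
  \<open>[0,T]\<close>; by causality this leaves the equation intact.
\<close>

theorem unique_solution: "\<exists>!X. X \<in> holder_space \<beta> {0..T} \<and> is_solution b \<sigma> z g T X"
proof (rule ex_ex1I)
  obtain X where X: "holder_path X" "\<And>t. t \<in> {0..T} \<Longrightarrow> X t = solution_map z X t"
    using fixed_point_exists[of z] by blast
  let ?X = "restrict X {0..T}"
  have hX: "holder_path ?X"
    using X(1) holder_bound_cong[of "{0..T}" ?X X] by (auto simp: holder_path_def)
  moreover have "?X t = solution_map z ?X t" if "t \<in> {0..T}" for t
  proof -
    have "solution_map z ?X t = solution_map z X t" using that by (intro solution_map_cong) auto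
    then show ?thesis using X(2) that by simp
  qed
  ultimately show "\<exists>X. X \<in> holder_space \<beta> {0..T} \<and> is_solution b \<sigma> z g T X"
    using is_solution_iff_fixed_point[OF hX]
    by (intro exI[of _ ?X]) (auto simp: holder_space_def holder_path_def holder_bound_def)
next
  fix X Y
  assume XY: "X \<in> holder_space \<beta> {0..T} \<and> is_solution b \<sigma> z g T X"
    "Y \<in> holder_space \<beta> {0..T} \<and> is_solution b \<sigma> z g T Y"
  then have h: "holder_path X" "holder_path Y"
    by (auto simp: holder_space_def holder_path_def holder_bound_def)
  then have "X t = Y t" if "t \<in> {0..T}" for t
    using XY that is_solution_iff_fixed_point by (intro fixed_point_unique[of X z Y t]) auto
  with XY show "X = Y" by (intro extensionalityI[of X "{0..T}" Y]) (auto simp: holder_space_def)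
qed

end


lemma globally_lipschitzE:
  assumes "globally_lipschitz f"
  obtains L where "L \<ge> 0" "\<And>s t x y. s \<ge> 0 \<Longrightarrow> t \<ge> 0 \<Longrightarrow>
    \<bar>f t x - f s y\<bar> \<le> L * (\<bar>t - s\<bar> + \<bar>x - y\<bar>)"
proof -
  from assms obtain L where L: "L-lipschitz_on ({0..} \<times> UNIV) (\<lambda>(t, x). f t x)"
    unfolding globally_lipschitz_def by blast
  show ?thesis
  proof (rule that)
    show L0: "L \<ge> 0" using L by (rule lipschitz_on_nonneg)
    fix s t x y :: real assume "s \<ge> 0" "t \<ge> 0"
    then have "\<bar>f t x - f s y\<bar> \<le> L * dist (t, x) (s, y)"
      using lipschitz_onD[OF L, of "(t, x)" "(s, y)"] by (simp add: dist_real_def)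
    also have "dist (t, x) (s, y) \<le> \<bar>t - s\<bar> + \<bar>x - y\<bar>"
      using sqrt_sum_squares_le_sum[of "\<bar>t - s\<bar>" "\<bar>x - y\<bar>"] by (simp add: dist_Pair_Pair dist_real_def)
    then have "L * dist (t, x) (s, y) \<le> L * (\<bar>t - s\<bar> + \<bar>x - y\<bar>)" using L0 by (rule mult_left_mono)
    finally show "\<bar>f t x - f s y\<bar> \<le> L * (\<bar>t - s\<bar> + \<bar>x - y\<bar>)" .
  qed
qed

lemma abs_deriv_le_lipschitz:
  fixes f :: "real \<Rightarrow> real"
  assumes f: "(f has_real_derivative D) (at x)" and lip: "\<And>y. \<bar>f y - f x\<bar> \<le> L * \<bar>y - x\<bar>"
  shows "\<bar>D\<bar> \<le> L"
proof -
  have "((\<lambda>y. \<bar>(f y - f x) / (y - x)\<bar>) \<longlongrightarrow> \<bar>D\<bar>) (at x)"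
    using f by (intro tendsto_rabs) (simp add: has_field_derivative_iff)
  moreover have "\<forall>\<^sub>F y in at x. \<bar>(f y - f x) / (y - x)\<bar> \<le> L"
    unfolding eventually_at_filter
  proof (intro always_eventually allI impI)
    fix y assume "y \<noteq> x"
    then show "\<bar>(f y - f x) / (y - x)\<bar> \<le> L" using lip[of y] by (simp add: pos_divide_le_eq)
  qed
  ultimately show ?thesis by (rule tendsto_upperbound) simp
qed

text \<open>
  The mean value theorem along the two segments from \<open>y\<close> to \<open>x\<close> and from \<open>y'\<close> to \<open>x'\<close>,
  run through simultaneously, compares \<open>\<sigma>x\<close> at two points whose distance is controlled by the
  distances of the end points.
\<close>

lemma second_difference_bound:
  fixes \<sigma> \<sigma>x :: "real \<Rightarrow> real \<Rightarrow> real"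
  assumes deriv: "\<And>t x. t \<ge> 0 \<Longrightarrow> (\<sigma> t has_real_derivative \<sigma>x t x) (at x)"
    and bound: "\<And>t x. t \<ge> 0 \<Longrightarrow> \<bar>\<sigma>x t x\<bar> \<le> L"
    and lip: "\<And>s t x y. s \<ge> 0 \<Longrightarrow> t \<ge> 0 \<Longrightarrow> \<bar>\<sigma>x t x - \<sigma>x s y\<bar> \<le> L * (\<bar>t - s\<bar> + \<bar>x - y\<bar>)"
    and L: "L \<ge> 0" and st: "s \<ge> 0" "t \<ge> 0"
  shows "\<bar>(\<sigma> t x - \<sigma> t y) - (\<sigma> s x' - \<sigma> s y')\<bar>
    \<le> L * (\<bar>(x - y) - (x' - y')\<bar> + \<bar>x' - y'\<bar> * (\<bar>t - s\<bar> + \<bar>x - x'\<bar> + \<bar>y - y'\<bar>))"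
proof -
  let ?p = "\<lambda>r. y + r * (x - y)" and ?q = "\<lambda>r. y' + r * (x' - y')"
  have "((\<lambda>r. \<sigma> t (?p r) - \<sigma> s (?q r)) has_real_derivative
      \<sigma>x t (?p r) * (x - y) - \<sigma>x s (?q r) * (x' - y')) (at r)" for r
  proof (rule DERIV_diff)
    show "((\<lambda>r. \<sigma> t (?p r)) has_real_derivative \<sigma>x t (?p r) * (x - y)) (at r)"
      by (rule DERIV_chain2[where g = ?p, OF deriv[OF st(2)]]) (auto intro!: derivative_eq_intros)
    show "((\<lambda>r. \<sigma> s (?q r)) has_real_derivative \<sigma>x s (?q r) * (x' - y')) (at r)"
      by (rule DERIV_chain2[where g = ?q, OF deriv[OF st(1)]]) (auto intro!: derivative_eq_intros)
  qed
  from MVT2[of 0 1 "\<lambda>r. \<sigma> t (?p r) - \<sigma> s (?q r)", OF _ this]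
  obtain r where r: "0 < r" "r < 1" "(\<sigma> t x - \<sigma> s x') - (\<sigma> t y - \<sigma> s y')
      = \<sigma>x t (?p r) * (x - y) - \<sigma>x s (?q r) * (x' - y')" by auto
  have "\<bar>?p r - ?q r\<bar> = \<bar>(1 - r) * (y - y') + r * (x - x')\<bar>"
    by (rule arg_cong[where f = abs]) (simp add: algebra_simps)
  also have "\<dots> \<le> \<bar>(1 - r) * (y - y')\<bar> + \<bar>r * (x - x')\<bar>" by (rule abs_triangle_ineq)
  also have "\<dots> \<le> 1 * \<bar>y - y'\<bar> + 1 * \<bar>x - x'\<bar>"
    unfolding abs_mult using r by (intro add_mono mult_right_mono) auto
  finally have pq: "\<bar>?p r - ?q r\<bar> \<le> \<bar>x - x'\<bar> + \<bar>y - y'\<bar>" by simp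
  have "\<bar>\<sigma>x t (?p r) - \<sigma>x s (?q r)\<bar> \<le> L * (\<bar>t - s\<bar> + \<bar>?p r - ?q r\<bar>)" using st by (intro lip) auto
  also have "\<dots> \<le> L * (\<bar>t - s\<bar> + \<bar>x - x'\<bar> + \<bar>y - y'\<bar>)" using pq L by (intro mult_left_mono) auto
  finally have lip': "\<bar>\<sigma>x t (?p r) - \<sigma>x s (?q r)\<bar> \<le> L * (\<bar>t - s\<bar> + \<bar>x - x'\<bar> + \<bar>y - y'\<bar>)" .
  have "(\<sigma> t x - \<sigma> t y) - (\<sigma> s x' - \<sigma> s y')
      = \<sigma>x t (?p r) * ((x - y) - (x' - y')) + (\<sigma>x t (?p r) - \<sigma>x s (?q r)) * (x' - y')"
    using r(3) by (simp add: algebra_simps)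
  also have "\<bar>\<dots>\<bar> \<le> \<bar>\<sigma>x t (?p r) * ((x - y) - (x' - y'))\<bar> + \<bar>(\<sigma>x t (?p r) - \<sigma>x s (?q r)) * (x' - y')\<bar>"
    by (rule abs_triangle_ineq)
  also have "\<dots> \<le> L * \<bar>(x - y) - (x' - y')\<bar>
      + (L * (\<bar>t - s\<bar> + \<bar>x - x'\<bar> + \<bar>y - y'\<bar>)) * \<bar>x' - y'\<bar>"
    unfolding abs_mult using st by (intro add_mono mult_right_mono bound lip') auto
  finally show ?thesis by (simp add: algebra_simps)
qed

theorem unique_solution_of_holder_driver:
  assumes "T > 0" "0 < \<beta>" "\<beta> < \<gamma>" "\<gamma> < 1" "\<beta> + \<gamma> > 1"
    and "G \<ge> 0" "holder_bound \<gamma> G {0..T} g"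
    and b: "globally_lipschitz b" and C1: "C1_with_partials \<sigma> \<sigma>t \<sigma>x"
    and \<sigma>: "globally_lipschitz \<sigma>" and \<sigma>x: "globally_lipschitz \<sigma>x"
  shows "\<exists>!X. X \<in> holder_space \<beta> {0..T} \<and> is_solution b \<sigma> z g T X"
proof -
  obtain L1 where L1: "L1 \<ge> 0" "\<And>s t x y. s \<ge> 0 \<Longrightarrow> t \<ge> 0 \<Longrightarrow>
      \<bar>b t x - b s y\<bar> \<le> L1 * (\<bar>t - s\<bar> + \<bar>x - y\<bar>)"
    using globally_lipschitzE[OF b] by metis
  obtain L2 where L2: "L2 \<ge> 0" "\<And>s t x y. s \<ge> 0 \<Longrightarrow> t \<ge> 0 \<Longrightarrow>
      \<bar>\<sigma> t x - \<sigma> s y\<bar> \<le> L2 * (\<bar>t - s\<bar> + \<bar>x - y\<bar>)"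
    using globally_lipschitzE[OF \<sigma>] by metis
  obtain L3 where L3: "L3 \<ge> 0" "\<And>s t x y. s \<ge> 0 \<Longrightarrow> t \<ge> 0 \<Longrightarrow>
      \<bar>\<sigma>x t x - \<sigma>x s y\<bar> \<le> L3 * (\<bar>t - s\<bar> + \<bar>x - y\<bar>)"
    using globally_lipschitzE[OF \<sigma>x] by metis
  define L where "L = L1 + L2 + L3"
  have L: "L \<ge> 0" "L1 \<le> L" "L2 \<le> L" "L3 \<le> L" using L1 L2 L3 by (auto simp: L_def)
  have weaken: "u \<le> L * (\<bar>t - s\<bar> + \<bar>x - y\<bar>)" if "u \<le> L' * (\<bar>t - s\<bar> + \<bar>x - y\<bar>)" "L' \<le> L"
    for u L' s t x y
    using that(1) mult_right_mono[OF that(2), of "\<bar>t - s\<bar> + \<bar>x - y\<bar>"] by linarith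
  have deriv: "(\<sigma> t has_real_derivative \<sigma>x t x) (at x)" if "t \<ge> 0" for t x
    using C1 that by (simp add: C1_with_partials_def)
  have bound: "\<bar>\<sigma>x t x\<bar> \<le> L" if "t \<ge> 0" for t x
    using abs_deriv_le_lipschitz[OF deriv[OF that], of x L2] L2(2)[OF that that] L by force
  interpret rough_equation T \<beta> \<gamma> G L g b \<sigma>
  proof
    fix s t x y x' y' :: real assume st: "s \<ge> 0" "t \<ge> 0"
    show "\<bar>b t x - b s y\<bar> \<le> L * (\<bar>t - s\<bar> + \<bar>x - y\<bar>)" by (rule weaken[OF L1(2)[OF st] L(2)])
    show "\<bar>\<sigma> t x - \<sigma> s y\<bar> \<le> L * (\<bar>t - s\<bar> + \<bar>x - y\<bar>)" by (rule weaken[OF L2(2)[OF st] L(3)])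
    show "\<bar>(\<sigma> t x - \<sigma> t y) - (\<sigma> s x' - \<sigma> s y')\<bar>
        \<le> L * (\<bar>(x - y) - (x' - y')\<bar> + \<bar>x' - y'\<bar> * (\<bar>t - s\<bar> + \<bar>x - x'\<bar> + \<bar>y - y'\<bar>))"
      by (rule second_difference_bound[OF deriv bound weaken[OF L3(2) L(4)] L(1) st])
  qed (use assms L in auto)
  show ?thesis by (rule unique_solution)
qed

section \<open>Hoelder paths of fractional Brownian motion\<close>

text \<open>
  Chaining: \<open>g t\<close> is reached from the value at its left grid point of level \<open>n\<close> by a sum of dyadic
  increments over finer and finer levels, with a geometric bound. Two points are joined at the
  level comparable with their distance, where their grid points coincide or are neighbours.
\<close>

lemma holder_bound_of_dyadic_increments:
  fixes g :: "real \<Rightarrow> real"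
  assumes T: "T > 0" and \<gamma>: "\<gamma> > 0" and cont: "continuous_on {0..T} g"
    and dyadic: "\<And>n i. i < 2 ^ n \<Longrightarrow>
      \<bar>g (real (Suc i) * (T / 2 ^ n)) - g (real i * (T / 2 ^ n))\<bar> \<le> K * (2 powr - \<gamma>) ^ n"
  obtains G where "G \<ge> 0" "holder_bound \<gamma> G {0..T} g"
proof -
  define \<rho> where "\<rho> = (2::real) powr - \<gamma>"
  have \<rho>: "0 < \<rho>" "\<rho> < 1"
    using \<gamma> powr_less_cancel_iff[of 2 "- \<gamma>" 0] by (auto simp: \<rho>_def)
  have K: "K \<ge> 0" using order_trans[OF abs_ge_zero dyadic[of 0 0]] by simp
  define h where "h n = T / 2 ^ n" for n :: nat
  define c where "c n t = grid_index 0 (h n) t" for n t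
  define p where "p n t = real (c n t) * h n" for n t
  have h: "h n > 0" for n using T by (simp add: h_def)
  have h_Suc: "h (Suc n) = h n / 2" for n by (simp add: h_def)
  have T_grid: "T = 2 ^ n * h n" for n by (simp add: h_def)
  have p: "0 \<le> p n t" "p n t \<le> t" "t < p n t + h n" if "0 \<le> t" for n t
    using grid_index_bounds[OF h that, of n] h[of n] by (auto simp: p_def c_def algebra_simps)
  have step: "\<bar>g (real (Suc i) * h n) - g (real i * h n)\<bar> \<le> K * \<rho> ^ n"
    if "real (Suc i) * h n \<le> T" for n i
  proof -
    have "real (Suc i) \<le> 2 ^ n" using that h[of n] T_grid[of n] by simp
    then have "i < 2 ^ n" by (metis Suc_le_lessD of_nat_le_iff of_nat_numeral of_nat_power)
    then show ?thesis using dyadic[of i n] by (simp add: h_def \<rho>_def)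
  qed
  have tail: "\<bar>g t - g (p n t)\<bar> \<le> K * \<rho> ^ n / (1 - \<rho>)" if t: "t \<in> {0..T}" for n t
  proof -
    have t0: "0 \<le> t" using t by simp
    have incr: "\<bar>g (p (Suc n) t) - g (p n t)\<bar> \<le> K * \<rho> ^ n" for n
    proof -
      consider "c (Suc n) t = 2 * c n t" | "c (Suc n) t = Suc (2 * c n t)"
        using grid_index_halve[OF h[of n] t0] by (auto simp: c_def h_Suc)
      then show ?thesis
      proof cases
        case 1
        then have "p (Suc n) t = p n t" by (simp add: p_def h_Suc)
        then show ?thesis using K \<rho> by simp
      next
        case 2
        have eq: "p (Suc n) t = real (Suc (2 * c n t)) * h (Suc n)" "p n t = real (2 * c n t) * h (Suc n)"
          using 2 by (simp_all add: p_def h_Suc)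
        have "\<bar>g (p (Suc n) t) - g (p n t)\<bar> \<le> K * \<rho> ^ Suc n"
          using step[of "2 * c n t" "Suc n"] p(2)[OF t0, of "Suc n"] t unfolding eq by simp
        also have "\<dots> \<le> K * \<rho> ^ n" using K \<rho> by (intro mult_left_mono power_decreasing) auto
        finally show ?thesis .
      qed
    qed
    have "(\<lambda>n. p n t) \<longlonglongrightarrow> t"
    proof -
      have "(\<lambda>n. T * (1/2) ^ n) \<longlonglongrightarrow> T * 0" by (intro tendsto_intros LIMSEQ_power_zero) simp
      then have null: "(\<lambda>n. T * (1/2) ^ n) \<longlonglongrightarrow> 0" by simp
      have le: "norm (p n t - t) \<le> T * (1/2) ^ n" for n
        using p(2,3)[OF t0, of n] by (simp add: h_def power_one_over)
      have "(\<lambda>n. p n t - t) \<longlonglongrightarrow> 0"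
        by (rule Lim_null_comparison[OF _ null]) (intro always_eventually allI le)
      then show ?thesis by (simp add: LIM_zero_iff)
    qed
    moreover have "p n t \<in> {0..T}" for n using p(1,2)[OF t0, of n] t by auto
    ultimately have lim: "(\<lambda>n. g (p n t)) \<longlonglongrightarrow> g t"
      using t by (intro continuous_on_tendsto_compose[OF cont]) auto
    show ?thesis
    proof (rule geometric_increments_limit[of "\<lambda>n. g (p n t)", OF incr less_imp_le[OF \<rho>(1)] \<rho>(2)])
      fix l assume "(\<lambda>n. g (p n t)) \<longlonglongrightarrow> l"
        and bound: "\<And>n. \<bar>l - g (p n t)\<bar> \<le> K * \<rho> ^ n / (1 - \<rho>)"
      then have "l = g t" using lim LIMSEQ_unique by blast
      with bound show ?thesis by simp
    qed
  qed
  define C where "C = (1 + 2 / (1 - \<rho>)) * K"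
  have C: "C \<ge> 0" using K \<rho> by (simp add: C_def)
  have "holder_bound \<gamma> (C * (2 / T) powr \<gamma>) {0..T} g"
  proof (rule holder_boundI_ordered)
    fix s t assume st: "s \<in> {0..T}" "t \<in> {0..T}" "s < t"
    then obtain N where N: "T / 2 ^ Suc N < t - s" "t - s \<le> T / 2 ^ N"
      using dyadic_scale[of "t - s" T] by auto
    have near: "\<bar>g (p N t) - g (p N s)\<bar> \<le> K * \<rho> ^ N"
    proof -
      consider "c N t = c N s" | "c N t = Suc (c N s)"
        using grid_index_adjacent[OF h[of N], of 0 s t] st N(2) by (auto simp: c_def h_def)
      then show ?thesis
      proof cases
        case 1 then show ?thesis using K \<rho> by (simp add: p_def)
      next
        case 2
        then have "p N t = real (Suc (c N s)) * h N" by (simp add: p_def)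
        moreover have "p N t \<le> T" using p(2)[of t N] st by auto
        ultimately show ?thesis using step[of "c N s" N] by (simp only: p_def[of N s])
      qed
    qed
    have "\<rho> ^ N = (1 / 2 ^ N) powr \<gamma>"
      by (simp add: \<rho>_def powr_realpow[symmetric] powr_powr powr_minus_divide[symmetric] mult.commute)
    also have "\<dots> \<le> (2 / T * (t - s)) powr \<gamma>"
      using N T \<gamma> by (intro powr_mono2) (auto simp: field_simps)
    also have "\<dots> = (2 / T) powr \<gamma> * (t - s) powr \<gamma>" by (rule powr_mult)
    finally have scale: "\<rho> ^ N \<le> (2 / T) powr \<gamma> * (t - s) powr \<gamma>" .
    have "\<bar>g t - g s\<bar> \<le> 2 * (K * \<rho> ^ N / (1 - \<rho>)) + K * \<rho> ^ N"
      using near tail[OF st(1), of N] tail[OF st(2), of N] by linarith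
    also have "\<dots> = C * \<rho> ^ N" by (simp add: C_def algebra_simps)
    also have "\<dots> \<le> C * ((2 / T) powr \<gamma> * (t - s) powr \<gamma>)" using C scale by (intro mult_left_mono)
    finally show "\<bar>g t - g s\<bar> \<le> C * (2 / T) powr \<gamma> * (t - s) powr \<gamma>" by (simp add: mult.assoc)
  qed
  with C show ?thesis by (intro that[of "C * (2 / T) powr \<gamma>"]) auto
qed

text \<open>
  Let \<open>S\<close> be the sum, over all levels \<open>n\<close> and all dyadic increments of level \<open>n\<close>, of the \<open>2k\<close>-th
  powers weighted with \<open>q\<^bsup>n\<^esup> = 2\<^bsup>2k\<gamma>n\<^esup>\<close>. Level \<open>n\<close> has \<open>2\<^bsup>n\<^esup>\<close> terms of expectation
  \<open>O(q\<^bsup>n\<^esup> 2\<^bsup>-n(1+\<eta>)\<^esup>)\<close>, so \<open>S\<close> has finite expectation as \<open>2k\<gamma> < \<eta>\<close> and is finite almost surely. A finite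
  value of \<open>S\<close> bounds every single dyadic increment by \<open>S\<^bsup>1/2k\<^esup> 2\<^bsup>-\<gamma>n\<^esup>\<close>.
\<close>

theorem (in prob_space) kolmogorov_holder:
  fixes X :: "real \<Rightarrow> 'a \<Rightarrow> real"
  assumes T: "T > 0" and \<gamma>: "\<gamma> > 0" and k: "k > 0" and \<eta>: "2 * real k * \<gamma> < \<eta>"
    and meas: "\<And>t. t \<in> {0..T} \<Longrightarrow> X t \<in> borel_measurable M"
    and int: "\<And>s t. s \<in> {0..T} \<Longrightarrow> t \<in> {0..T} \<Longrightarrow> integrable M (\<lambda>\<omega>. (X t \<omega> - X s \<omega>) ^ (2 * k))"
    and moment: "\<And>s t. s \<in> {0..T} \<Longrightarrow> t \<in> {0..T} \<Longrightarrow>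
      expectation (\<lambda>\<omega>. (X t \<omega> - X s \<omega>) ^ (2 * k)) \<le> B * \<bar>t - s\<bar> powr (1 + \<eta>)"
    and cont: "AE \<omega> in M. continuous_on {0..T} (\<lambda>t. X t \<omega>)"
  shows "AE \<omega> in M. \<exists>G\<ge>0. holder_bound \<gamma> G {0..T} (\<lambda>t. X t \<omega>)"
proof -
  define q where "q = (2::real) powr (2 * real k * \<gamma>)"
  define h where "h n = T / 2 ^ n" for n :: nat
  define I where "I n i \<omega> = (X (real (Suc i) * h n) \<omega> - X (real i * h n) \<omega>) ^ (2 * k)" for n i \<omega>
  define S where "S \<omega> = (\<Sum>n. \<Sum>i<2^n. ennreal (q ^ n * I n i \<omega>))" for \<omega>
  have h: "h n > 0" for n using T by (simp add: h_def)
  have q: "q > 0" by (simp add: q_def)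
  have I0: "I n i \<omega> \<ge> 0" for n i \<omega> by (simp add: I_def)
  have grid: "real i * h n \<in> {0..T}" if "i \<le> 2 ^ n" for i n
  proof -
    have "real i \<le> real (2 ^ n)" using that by (simp only: of_nat_le_iff)
    then have "real i * h n \<le> 2 ^ n * h n" using h[of n] by simp
    then show ?thesis using T by (simp add: h_def)
  qed
  have measI: "I n i \<in> borel_measurable M" if "i < 2 ^ n" for n i
    unfolding I_def[abs_def] using that by (intro borel_measurable_power borel_measurable_diff meas grid) auto
  have expI: "(\<integral>\<^sup>+ \<omega>. ennreal (q ^ n * I n i \<omega>) \<partial>M) \<le> ennreal (q ^ n * (B * h n powr (1 + \<eta>)))"
    if i: "i < 2 ^ n" for n i
  proof -
    have g: "real i * h n \<in> {0..T}" "real (Suc i) * h n \<in> {0..T}" using grid[of i n] grid[of "Suc i" n] i by simp_all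
    have intI: "integrable M (I n i)" using int[OF g] by (simp add: I_def[abs_def])
    have "expectation (I n i) \<le> B * h n powr (1 + \<eta>)"
      using moment[OF g] h[of n] by (simp add: I_def[abs_def] algebra_simps)
    then have "q ^ n * expectation (I n i) \<le> q ^ n * (B * h n powr (1 + \<eta>))"
      using q by (intro mult_left_mono) auto
    then have "ennreal (expectation (\<lambda>\<omega>. q ^ n * I n i \<omega>)) \<le> ennreal (q ^ n * (B * h n powr (1 + \<eta>)))"
      by (intro ennreal_leI) simp
    then show ?thesis
      using intI q I0 by (subst nn_integral_eq_integral) auto
  qed
  define r where "r = (2::real) powr (2 * real k * \<gamma> - \<eta>)"
  have r: "0 < r" "r < 1" using \<eta> powr_less_cancel_iff[of 2 "2 * real k * \<gamma> - \<eta>" 0] by (auto simp: r_def)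
  have "B \<ge> 0"
  proof -
    have "0 \<le> expectation (\<lambda>\<omega>. (X T \<omega> - X 0 \<omega>) ^ (2 * k))" by (intro integral_nonneg_AE) auto
    also have "\<dots> \<le> B * T powr (1 + \<eta>)" using moment[of 0 T] T by simp
    finally show ?thesis using T by (simp add: zero_le_mult_iff)
  qed
  have level: "(\<integral>\<^sup>+ \<omega>. (\<Sum>i<2^n. ennreal (q ^ n * I n i \<omega>)) \<partial>M) \<le> ennreal (B * T powr (1 + \<eta>) * r ^ n)" for n
  proof -
    have "(\<integral>\<^sup>+ \<omega>. (\<Sum>i<2^n. ennreal (q ^ n * I n i \<omega>)) \<partial>M)
        = (\<Sum>i<2^n. \<integral>\<^sup>+ \<omega>. ennreal (q ^ n * I n i \<omega>) \<partial>M)"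
      by (intro nn_integral_sum measurable_compose[OF _ measurable_ennreal] borel_measurable_times measI) auto
    also have "\<dots> \<le> (\<Sum>i<(2::nat)^n. ennreal (q ^ n * (B * h n powr (1 + \<eta>))))"
      by (intro sum_mono expI) auto
    also have "\<dots> = ennreal (2 ^ n * (q ^ n * (B * h n powr (1 + \<eta>))))"
      using q \<open>B \<ge> 0\<close> by (subst sum_ennreal) auto
    also have "2 ^ n * (q ^ n * (B * h n powr (1 + \<eta>))) = B * T powr (1 + \<eta>) * r ^ n"
    proof -
      have "(2 powr (- (1 + \<eta>))) ^ n = 1 / (2 powr (1 + \<eta>)) ^ n"
        by (simp only: powr_minus_divide power_one_over)
      also have "(2 powr (1 + \<eta>)) ^ n = (2 ^ n) powr (1 + \<eta>)"
        by (simp add: powr_realpow[symmetric] powr_powr mult.commute)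
      finally have "h n powr (1 + \<eta>) = T powr (1 + \<eta>) * (2 powr (- (1 + \<eta>))) ^ n"
        using T by (simp add: h_def powr_divide)
      moreover have "r = 2 * q * 2 powr (- (1 + \<eta>))"
      proof -
        have "r = 2 powr (1 + 2 * real k * \<gamma> + - (1 + \<eta>))" by (simp add: r_def)
        then show ?thesis by (simp only: powr_add q_def) simp
      qed
      ultimately show ?thesis by (simp add: power_mult_distrib mult_ac)
    qed
    finally show ?thesis .
  qed
  have "(\<integral>\<^sup>+ \<omega>. S \<omega> \<partial>M) = (\<Sum>n. \<integral>\<^sup>+ \<omega>. (\<Sum>i<2^n. ennreal (q ^ n * I n i \<omega>)) \<partial>M)"
    unfolding S_def
    by (intro nn_integral_suminf borel_measurable_sum measurable_compose[OF _ measurable_ennreal]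
        borel_measurable_times measI) auto
  also have "\<dots> \<le> (\<Sum>n. ennreal (B * T powr (1 + \<eta>) * r ^ n))"
    by (intro suminf_le level) auto
  also have "\<dots> < \<infinity>"
  proof -
    have "summable (\<lambda>n. B * T powr (1 + \<eta>) * r ^ n)" using r by (intro summable_mult summable_geometric) auto
    then have "(\<Sum>n. ennreal (B * T powr (1 + \<eta>) * r ^ n)) = ennreal (\<Sum>n. B * T powr (1 + \<eta>) * r ^ n)"
      using \<open>B \<ge> 0\<close> r by (intro suminf_ennreal2) auto
    then show ?thesis by simp
  qed
  finally have fin: "(\<integral>\<^sup>+ \<omega>. S \<omega> \<partial>M) \<noteq> \<infinity>" by simp
  have "S \<in> borel_measurable M"
    unfolding S_def[abs_def]
    by (intro borel_measurable_suminf_order borel_measurable_sum measurable_compose[OF _ measurable_ennreal]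
        borel_measurable_times measI) auto
  from nn_integral_PInf_AE[OF this fin] cont show ?thesis
  proof eventually_elim
    case (elim \<omega>)
    define s where "s = enn2real (S \<omega>)"
    have s: "S \<omega> = ennreal s" "s \<ge> 0" using elim(1) by (auto simp: s_def less_top)
    define K where "K = root (2 * k) s"
    have K: "K \<ge> 0" "K ^ (2 * k) = s" using k s by (auto simp: K_def)
    have "\<bar>X (real (Suc i) * (T / 2 ^ n)) \<omega> - X (real i * (T / 2 ^ n)) \<omega>\<bar> \<le> K * (2 powr - \<gamma>) ^ n"
      if i: "i < 2 ^ n" for n i
    proof -
      have "ennreal (q ^ n * I n i \<omega>) \<le> (\<Sum>i<2^n. ennreal (q ^ n * I n i \<omega>))"
        using i by (intro member_le_sum) auto
      also have "\<dots> \<le> S \<omega>"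
        unfolding S_def using sum_le_suminf[of "\<lambda>n. \<Sum>i<2^n. ennreal (q ^ n * I n i \<omega>)" "{n}"] by simp
      finally have le: "q ^ n * I n i \<omega> \<le> s" using s by simp
      have inv: "((2 powr - \<gamma>) ^ n) ^ (2 * k) * q ^ n = 1"
        by (simp add: q_def powr_realpow[symmetric] powr_powr powr_add[symmetric] algebra_simps)
      have "\<bar>X (real (Suc i) * h n) \<omega> - X (real i * h n) \<omega>\<bar> ^ (2 * k) = I n i \<omega>"
        by (simp add: I_def power_even_abs)
      also have "\<dots> = ((2 powr - \<gamma>) ^ n) ^ (2 * k) * (q ^ n * I n i \<omega>)"
        using inv by (simp add: mult.assoc[symmetric])
      also have "\<dots> \<le> ((2 powr - \<gamma>) ^ n) ^ (2 * k) * s" using le by (intro mult_left_mono) auto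
      also have "\<dots> = (K * (2 powr - \<gamma>) ^ n) ^ (2 * k)" using K by (simp add: power_mult_distrib)
      finally have pw: "\<bar>X (real (Suc i) * h n) \<omega> - X (real i * h n) \<omega>\<bar> ^ (2 * k)
          \<le> (K * (2 powr - \<gamma>) ^ n) ^ (2 * k)" .
      show ?thesis
        unfolding h_def[symmetric]
      proof (rule power_mono_iff[THEN iffD1, OF _ _ _ pw])
        show "0 < 2 * k" using k by simp
      qed (use K in simp_all)
    qed
    from holder_bound_of_dyadic_increments[of T \<gamma> "\<lambda>t. X t \<omega>" K, OF T \<gamma> elim(2) this]
    show ?case by metis
  qed
qed

text \<open>
  For a degenerate law the formula for the moments holds as well: for \<open>k > 0\<close> both sides vanish,
  and for \<open>k = 0\<close> both are 1.
\<close>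

lemma (in prob_space) centered_normal_moments:
  assumes Y: "normal_rv M Y" and mean: "expectation Y = 0"
  shows "integrable M Y" (is ?A)
    and "integrable M (\<lambda>\<omega>. Y \<omega> ^ (2 * k))" (is ?B)
    and "expectation (\<lambda>\<omega>. Y \<omega> ^ (2 * k))
      = fact (2 * k) / (2 ^ k * fact k) * expectation (\<lambda>\<omega>. (Y \<omega>)\<^sup>2) ^ k" (is ?C)
proof -
  have "?A \<and> ?B \<and> ?C"
    using Y unfolding normal_rv_def
  proof (elim disjE exE conjE)
    fix \<mu> s :: real assume s: "s > 0" and "distributed M lborel Y (normal_density \<mu> s)"
    moreover from this have "\<mu> = 0" using mean normal_distributed_expectation by metis
    ultimately have D: "distributed M lborel Y (normal_density 0 s)" by simp
    have int: "integrable M (\<lambda>\<omega>. Y \<omega> ^ j)" for j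
      using distributed_integrable[OF D, of "\<lambda>x. x ^ j"] integrable_normal_moment[OF s, of 0 j] by simp
    have mom: "expectation (\<lambda>\<omega>. Y \<omega> ^ (2 * j)) = fact (2 * j) / ((2 / s\<^sup>2) ^ j * fact j)" for j
      using distributed_integral[OF D, of "\<lambda>x. x ^ (2 * j)"] integral_normal_moment_even[OF s, of 0 j] by simp
    have "expectation (\<lambda>\<omega>. (Y \<omega>)\<^sup>2) = s\<^sup>2" using mom[of 1] s by (simp add: fact_numeral)
    then show ?thesis using int[of 1] int[of "2 * k"] mom[of k] s by (simp add: power_divide)
  next
    fix \<mu> assume m: "Y \<in> borel_measurable M" and "AE \<omega> in M. Y \<omega> = \<mu>"
    moreover from this have "expectation Y = expectation (\<lambda>_. \<mu>)" by (intro integral_cong_AE) auto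
    ultimately have ae: "AE \<omega> in M. Y \<omega> = 0" using mean by (simp add: prob_space)
    have int: "integrable M (\<lambda>\<omega>. Y \<omega> ^ j)" for j
      using ae m by (subst integrable_cong_AE[of _ _ "\<lambda>_. 0 ^ j"]) auto
    have mom: "expectation (\<lambda>\<omega>. Y \<omega> ^ j) = 0 ^ j" for j
    proof -
      have "expectation (\<lambda>\<omega>. Y \<omega> ^ j) = expectation (\<lambda>_. 0 ^ j)" using ae m by (intro integral_cong_AE) auto
      then show ?thesis by (simp add: prob_space)
    qed
    show ?thesis using int[of 1] int[of "2 * k"] mom[of "2 * k"] mom[of 2] by (cases k) auto
  qed
  then show ?A ?B ?C by auto
qed

lemma (in prob_space) fbm_increment_moments:
  assumes fbm: "fractional_brownian_motion M \<alpha> \<xi>" and st: "s \<ge> 0" "t \<ge> 0"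
  shows "integrable M (\<lambda>\<omega>. (\<xi> t \<omega> - \<xi> s \<omega>) ^ (2 * k))" (is ?A)
    and "expectation (\<lambda>\<omega>. (\<xi> t \<omega> - \<xi> s \<omega>) ^ (2 * k))
      = fact (2 * k) / (2 ^ k * fact k) * (2 * fbm_const \<alpha> * \<bar>t - s\<bar> powr (1 + \<alpha>)) ^ k" (is ?B)
proof -
  have gauss: "gaussian_process M {0..} \<xi>"
    and mean: "\<And>t. t \<ge> 0 \<Longrightarrow> expectation (\<xi> t) = 0"
    and cov: "\<And>s t. s \<ge> 0 \<Longrightarrow> t \<ge> 0 \<Longrightarrow> expectation (\<lambda>\<omega>. \<xi> s \<omega> * \<xi> t \<omega>) =
      fbm_const \<alpha> * (s powr (1 + \<alpha>) + t powr (1 + \<alpha>) - \<bar>s - t\<bar> powr (1 + \<alpha>))"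
    using fbm by (auto simp: fractional_brownian_motion_def)
  have lin: "normal_rv M (\<lambda>\<omega>. \<Sum>t\<in>J. c t * \<xi> t \<omega>)" if "finite J" "J \<subseteq> {0..}" for J c
    using gauss that by (simp add: gaussian_process_def)
  have normal: "normal_rv M (\<xi> t)" if "t \<ge> 0" for t using lin[of "{t}" "\<lambda>_. 1"] that by simp
  let ?Y = "\<lambda>\<omega>. \<xi> t \<omega> - \<xi> s \<omega>"
  have normalY: "normal_rv M ?Y"
  proof (cases "s = t")
    case True then show ?thesis using lin[of "{}"] by simp
  next
    case False
    then show ?thesis using lin[of "{s, t}" "\<lambda>r. if r = t then 1 else - 1"] st by simp
  qed
  have int: "integrable M (\<xi> t)" "integrable M (\<lambda>\<omega>. \<xi> t \<omega> * \<xi> t \<omega>)" if "t \<ge> 0" for t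
    using centered_normal_moments(1)[OF normal[OF that] mean[OF that]] centered_normal_moments(2)[OF normal[OF that] mean[OF that], of 1] that
    by (auto simp: power2_eq_square)
  have meanY: "expectation ?Y = 0" using int st mean by simp
  have intY: "integrable M (\<lambda>\<omega>. (?Y \<omega>)\<^sup>2)" using centered_normal_moments(2)[OF normalY meanY, of 1] by simp
  \<comment> \<open>Integrability of the mixed product comes for free by polarization: all three squares are
    integrable.\<close>
  have "integrable M (\<lambda>\<omega>. (\<xi> s \<omega> * \<xi> s \<omega> + \<xi> t \<omega> * \<xi> t \<omega> - (?Y \<omega>)\<^sup>2) / 2)"
    using int st intY by simp
  moreover have "(\<lambda>\<omega>. (\<xi> s \<omega> * \<xi> s \<omega> + \<xi> t \<omega> * \<xi> t \<omega> - (?Y \<omega>)\<^sup>2) / 2) = (\<lambda>\<omega>. \<xi> s \<omega> * \<xi> t \<omega>)"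
    by (simp add: fun_eq_iff power2_eq_square field_simps)
  ultimately have intst: "integrable M (\<lambda>\<omega>. \<xi> s \<omega> * \<xi> t \<omega>)" by simp
  have "expectation (\<lambda>\<omega>. (?Y \<omega>)\<^sup>2)
      = expectation (\<lambda>\<omega>. \<xi> t \<omega> * \<xi> t \<omega> + \<xi> s \<omega> * \<xi> s \<omega> - 2 * (\<xi> s \<omega> * \<xi> t \<omega>))"
    by (intro Bochner_Integration.integral_cong) (auto simp: power2_eq_square algebra_simps)
  also have "\<dots> = expectation (\<lambda>\<omega>. \<xi> t \<omega> * \<xi> t \<omega>) + expectation (\<lambda>\<omega>. \<xi> s \<omega> * \<xi> s \<omega>)
      - 2 * expectation (\<lambda>\<omega>. \<xi> s \<omega> * \<xi> t \<omega>)"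
    using int st intst by simp
  also have "\<dots> = 2 * fbm_const \<alpha> * \<bar>t - s\<bar> powr (1 + \<alpha>)"
    using st by (simp add: cov abs_minus_commute algebra_simps)
  finally have var: "expectation (\<lambda>\<omega>. (?Y \<omega>)\<^sup>2) = 2 * fbm_const \<alpha> * \<bar>t - s\<bar> powr (1 + \<alpha>)" .
  show ?A by (rule centered_normal_moments(2)[OF normalY meanY])
  show ?B using centered_normal_moments(3)[OF normalY meanY, of k] by (simp only: var)
qed

text \<open>
  The exponent of the \<open>2k\<close>-th moment is \<open>k (1+\<alpha>) = 1 + \<eta>\<close>, and the criterion asks for
  \<open>2k\<gamma> < \<eta>\<close>. As \<open>2\<gamma> < 1 + \<alpha>\<close>, this holds for large \<open>k\<close>.
\<close>

theorem (in prob_space) fbm_holder_paths: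
  assumes fbm: "fractional_brownian_motion M \<alpha> \<xi>"
    and \<gamma>: "0 < \<gamma>" "\<gamma> < (1 + \<alpha>) / 2" and T: "T > 0"
  shows "AE \<omega> in M. \<exists>G\<ge>0. holder_bound \<gamma> G {0..T} (\<lambda>t. \<xi> t \<omega>)"
proof -
  have gap: "1 + \<alpha> - 2 * \<gamma> > 0" using \<gamma> by simp
  obtain k where "1 / (1 + \<alpha> - 2 * \<gamma>) < real k" using reals_Archimedean2 by blast
  then have "1 < real k * (1 + \<alpha> - 2 * \<gamma>)" using gap by (simp add: field_simps)
  then have k: "2 * real k * \<gamma> < real k * (1 + \<alpha>) - 1" "k > 0" by (auto simp: algebra_simps intro: gr0I)
  define B where "B = fact (2 * k) / (2 ^ k * fact k) * (2 * fbm_const \<alpha>) ^ k"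
  show ?thesis
  proof (rule kolmogorov_holder[OF T \<gamma>(1) k(2,1)])
    show "\<xi> t \<in> borel_measurable M" if "t \<in> {0..T}" for t
      using fbm that by (simp add: fractional_brownian_motion_def gaussian_process_def)
    fix s t assume st: "s \<in> {0..T}" "t \<in> {0..T}"
    then show "integrable M (\<lambda>\<omega>. (\<xi> t \<omega> - \<xi> s \<omega>) ^ (2 * k))"
      using fbm by (intro fbm_increment_moments(1)) auto
    have "(\<bar>t - s\<bar> powr (1 + \<alpha>)) ^ k = \<bar>t - s\<bar> powr (1 + (real k * (1 + \<alpha>) - 1))"
      using k(2) powr_power[of "\<bar>t - s\<bar>" "1 + \<alpha>" k]
      by (cases "t = s") (simp_all add: mult.commute)
    then show "expectation (\<lambda>\<omega>. (\<xi> t \<omega> - \<xi> s \<omega>) ^ (2 * k))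
        \<le> B * \<bar>t - s\<bar> powr (1 + (real k * (1 + \<alpha>) - 1))"
      using st fbm_increment_moments(2)[OF fbm, of s t k]
      by (simp add: B_def power_mult_distrib)
  next
    have "AE \<omega> in M. continuous_on {0..} (\<lambda>t. \<xi> t \<omega>)"
      using fbm by (simp add: fractional_brownian_motion_def)
    then show "AE \<omega> in M. continuous_on {0..T} (\<lambda>t. \<xi> t \<omega>)"
      by eventually_elim (rule continuous_on_subset, auto)
  qed
qed

section \<open>The stochastic equation\<close>

theorem theorem4:
  fixes M :: "'a measure"
    and b \<sigma> \<sigma>t \<sigma>x :: "real \<Rightarrow> real \<Rightarrow> real"
    and Z :: "'a \<Rightarrow> real"
    and \<xi> :: "real \<Rightarrow> 'a \<Rightarrow> real"
    and \<alpha> \<beta> T :: real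
  assumes "prob_space M"
    and "0 < \<alpha>" and "\<alpha> < 1"
    and "(1 - \<alpha>) / 2 < \<beta>" and "\<beta> < (1 + \<alpha>) / 2"
    and "fractional_brownian_motion M \<alpha> \<xi>"
    and "globally_lipschitz b"
    and "C1_with_partials \<sigma> \<sigma>t \<sigma>x"
    and "globally_lipschitz \<sigma>" and "globally_lipschitz \<sigma>t" and "globally_lipschitz \<sigma>x"
    and "T > 0"
  shows "AE \<omega> in M. \<exists>!X. X \<in> holder_space \<beta> {0..T} \<and>
           is_solution b \<sigma> (Z \<omega>) (\<lambda>t. \<xi> t \<omega>) T X"
proof -
  interpret prob_space M by fact
  have "max \<beta> (1 - \<beta>) < (1 + \<alpha>) / 2" unfolding max_less_iff_conj
    using assms(3-5) by (simp add: field_simps)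
  then obtain \<gamma> where \<gamma>: "max \<beta> (1 - \<beta>) < \<gamma>" "\<gamma> < (1 + \<alpha>) / 2"
    using dense by blast
  have \<beta>: "\<beta> > 0" using assms(3,4) by simp
  have "AE \<omega> in M. \<exists>G\<ge>0. holder_bound \<gamma> G {0..T} (\<lambda>t. \<xi> t \<omega>)"
    using \<gamma> \<beta> assms(6,12) by (intro fbm_holder_paths) auto
  then show ?thesis
  proof eventually_elim
    case (elim \<omega>)
    then obtain G where "G \<ge> 0" "holder_bound \<gamma> G {0..T} (\<lambda>t. \<xi> t \<omega>)" by blast
    then show ?case
      using \<gamma> \<beta> assms by (intro unique_solution_of_holder_driver[of T \<beta> \<gamma> G _ b \<sigma> \<sigma>t \<sigma>x]) auto
  qed
qed

end
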